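(* Let $n,d$ be positive integers such that $d<\frac{n-2}{2}$. Let $(S^{n-d-1},g_0)$ be the standard sphere of curvature $+1$ and let $(M^{d+1},g_1)$ be a compact connected space form of curvature $-1$ and dimension $d+1$. Denote by $g$ the Riemannian product metric of $g_0$ and $g_1$ on $S^{n-d-1}\times M^{d+1}$. Then \[\mathrm{Ein}([g])=\mathrm{Ein}(g)=(n-1)\frac{2d-n+2}{d-n+2}\quad\text{and}\quad \mathrm{ein}([g])=\mathrm{ein}(g)=-(n-1)\frac{n-2d-2}{d}.\] In other words, $g$ attains the supremum defining $\mathrm{Ein}([g])$ and the infimum defining $\mathrm{ein}([g])$.
   Context: For a Riemannian metric $g$ on a closed connected $n$-manifold $M$ and $k\in\mathbb{R}$, set $\mathrm{Ein}_k(g):=\mathrm{Scal}\,g-k\,\mathrm{Ric}$, where $\mathrm{Ric}$ and $\mathrm{Scal}$ are the Ricci and scalar curvatures of $g$; $\mathrm{Ein}_k(g)>0$ means this symmetric 2-tensor is positive definite at every point. If the scalar curvature of $g$ is positive everywhere, $\mathrm{Ein}(g):=\sup\{k\in(0,n): \mathrm{Ein}_k(g)>0\}$; otherwise $\mathrm{Ein}(g):=0$. If the scalar curvature of $g$ is positive everywhere, $\mathrm{ein}(g):=\inf\{k<0: \mathrm{Ein}_k(g)>0\}$, with $\mathrm{ein}(g)=-\infty$ if this set is unbounded below; otherwise $\mathrm{ein}(g):=0$. For the conformal class $[g]$ of $g$: $\mathrm{Ein}([g]):=\sup\{\mathrm{Ein}(\bar g):\bar g\in[g]\}$ and $\mathrm{ein}([g]):=\inf\{\mathrm{ein}(\bar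 g):\bar g\in[g]\}$. *)

theory Defs
  imports "HOL-Analysis.Analysis"
begin

section \<open>Smooth maps between Euclidean spaces\<close>

text \<open>Only meaningful for open \<open>S\<close>, since the derivative is taken in the full space.\<close>

primrec Ck_on :: "nat \<Rightarrow> 'a::euclidean_space set \<Rightarrow> ('a \<Rightarrow> 'b::euclidean_space) \<Rightarrow> bool" where
  "Ck_on 0 S f \<longleftrightarrow> continuous_on S f"
| "Ck_on (Suc k) S f \<longleftrightarrow>
     (\<forall>x\<in>S. f differentiable (at x)) \<and> (\<forall>v. Ck_on k S (\<lambda>x. frechet_derivative f (at x) v))"

definition smooth_on :: "'a::euclidean_space set \<Rightarrow> ('a \<Rightarrow> 'b::euclidean_space) \<Rightarrow> bool" where
  "smooth_on S f \<longleftrightarrow> (\<forall>k. Ck_on k S f)"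


section \<open>Smooth manifolds and Riemannian metrics\<close>

text \<open>
  A manifold is a topology on points of type \<open>'p\<close> together with an indexed smooth atlas
  (not necessarily maximal), whose charts take values in the model space \<open>'e\<close>; its dimension is
  \<open>DIM('e)\<close>. The values of \<open>chart M i\<close> outside \<open>chart_dom M i\<close> are irrelevant.
\<close>

record ('p, 'i, 'e) mfd =
  points :: "'p topology"
  charts :: "'i set"
  chart_dom :: "'i \<Rightarrow> 'p set"
  chart :: "'i \<Rightarrow> 'p \<Rightarrow> 'e"

definition chart_img :: "('p, 'i, 'e) mfd \<Rightarrow> 'i \<Rightarrow> 'e set" where
  "chart_img M i = chart M i ` chart_dom M i"

definition chart_inv :: "('p, 'i, 'e) mfd \<Rightarrow> 'i \<Rightarrow> 'e \<Rightarrow> 'p" where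
  "chart_inv M i = inv_into (chart_dom M i) (chart M i)"

definition transition :: "('p, 'i, 'e) mfd \<Rightarrow> 'i \<Rightarrow> 'i \<Rightarrow> 'e \<Rightarrow> 'e" where
  "transition M i j = chart M j \<circ> chart_inv M i"

definition overlap :: "('p, 'i, 'e) mfd \<Rightarrow> 'i \<Rightarrow> 'i \<Rightarrow> 'e set" where
  "overlap M i j = chart M i ` (chart_dom M i \<inter> chart_dom M j)"

definition smooth_manifold :: "('p, 'i, 'e::euclidean_space) mfd \<Rightarrow> bool" where
  "smooth_manifold M \<longleftrightarrow>
     Hausdorff_space (points M) \<and> second_countable (points M) \<and>
     (\<Union>i\<in>charts M. chart_dom M i) = topspace (points M) \<and>
     (\<forall>i\<in>charts M.
        openin (points M) (chart_dom M i) \<and> open (chart_img M i) \<and>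
        homeomorphic_map (subtopology (points M) (chart_dom M i))
          (top_of_set (chart_img M i)) (chart M i)) \<and>
     (\<forall>i\<in>charts M. \<forall>j\<in>charts M. smooth_on (overlap M i j) (transition M i j))"

definition smooth_function :: "('p, 'i, 'e::euclidean_space) mfd \<Rightarrow> ('p \<Rightarrow> real) \<Rightarrow> bool" where
  "smooth_function M f \<longleftrightarrow> (\<forall>i\<in>charts M. smooth_on (chart_img M i) (f \<circ> chart_inv M i))"

text \<open>
  A field of bilinear forms is given by its coordinate expressions: \<open>g i x u v\<close> is the value, at
  the point with coordinates \<open>x\<close> in chart \<open>i\<close>, on the tangent vectors with components
  \<open>u\<close>, \<open>v\<close> in that chart. The last condition below is the transformation law of a tensor.
\<close>

type_synonym 'e form_field = "'e \<Rightarrow> 'e \<Rightarrow> 'e \<Rightarrow> real"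

definition riemannian_metric ::
    "('p, 'i, 'e::euclidean_space) mfd \<Rightarrow> ('i \<Rightarrow> 'e form_field) \<Rightarrow> bool" where
  "riemannian_metric M g \<longleftrightarrow>
     (\<forall>i\<in>charts M.
        (\<forall>u v. smooth_on (chart_img M i) (\<lambda>x. g i x u v)) \<and>
        (\<forall>x\<in>chart_img M i.
           bilinear (g i x) \<and> (\<forall>u v. g i x u v = g i x v u) \<and> (\<forall>u. u \<noteq> 0 \<longrightarrow> g i x u u > 0))) \<and>
     (\<forall>i\<in>charts M. \<forall>j\<in>charts M. \<forall>x\<in>overlap M i j. \<forall>u v.
        g i x u v = g j (transition M i j x)
                        (frechet_derivative (transition M i j) (at x) u)
                        (frechet_derivative (transition M i j) (at x) v))"


section \<open>Curvature in a coordinate chart\<close>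

text \<open>
  \<open>christoffel h x u v\<close> is the covariant derivative, at \<open>x\<close>, of the constant coordinate field
  \<open>v\<close> in direction \<open>u\<close> for the Levi-Civita connection of \<open>h\<close>, characterised by the Koszul formula.
\<close>

definition christoffel :: "'e::euclidean_space form_field \<Rightarrow> 'e \<Rightarrow> 'e \<Rightarrow> 'e \<Rightarrow> 'e" where
  "christoffel h x u v = (THE w. \<forall>z. h x w z =
     (frechet_derivative (\<lambda>y. h y v z) (at x) u
    + frechet_derivative (\<lambda>y. h y u z) (at x) v
    - frechet_derivative (\<lambda>y. h y u v) (at x) z) / 2)"

text \<open>
  The sign convention is \<open>R(u,v)w = \<nabla>\<^sub>u \<nabla>\<^sub>v w - \<nabla>\<^sub>v \<nabla>\<^sub>u w\<close> for constant coordinate fields.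
\<close>

definition riemann :: "'e::euclidean_space form_field \<Rightarrow> 'e \<Rightarrow> 'e \<Rightarrow> 'e \<Rightarrow> 'e \<Rightarrow> 'e" where
  "riemann h x u v w =
     frechet_derivative (\<lambda>y. christoffel h y v w) (at x) u
   - frechet_derivative (\<lambda>y. christoffel h y u w) (at x) v
   + christoffel h x u (christoffel h x v w)
   - christoffel h x v (christoffel h x u w)"

definition sectional :: "'e::euclidean_space form_field \<Rightarrow> 'e \<Rightarrow> 'e \<Rightarrow> 'e \<Rightarrow> real" where
  "sectional h x u v =
     h x (riemann h x u v v) u / (h x u u * h x v v - (h x u v)\<^sup>2)"

text \<open>
  The trace of a linear endomorphism can be computed in any basis of \<open>'e\<close>, in particular in the
  (not \<open>h\<close>-orthonormal) standard one.
\<close>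

definition endo_trace :: "('e::euclidean_space \<Rightarrow> 'e) \<Rightarrow> real" where
  "endo_trace L = (\<Sum>b\<in>Basis. L b \<bullet> b)"

definition Ric :: "'e::euclidean_space form_field \<Rightarrow> 'e form_field" where
  "Ric h x v w = endo_trace (\<lambda>u. riemann h x u v w)"

definition Scal :: "'e::euclidean_space form_field \<Rightarrow> 'e \<Rightarrow> real" where
  "Scal h x = endo_trace (\<lambda>u. THE w. \<forall>z. h x w z = Ric h x u z)"

definition Ein_tensor :: "real \<Rightarrow> 'e::euclidean_space form_field \<Rightarrow> 'e form_field" where
  "Ein_tensor k h x u v = Scal h x * h x u v - k * Ric h x u v"


section \<open>The invariants Ein and ein\<close>

definition Scal_pos :: "('p, 'i, 'e::euclidean_space) mfd \<Rightarrow> ('i \<Rightarrow> 'e form_field) \<Rightarrow> bool" where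
  "Scal_pos M g \<longleftrightarrow> (\<forall>i\<in>charts M. \<forall>x\<in>chart_img M i. Scal (g i) x > 0)"

definition Ein_pos ::
    "('p, 'i, 'e::euclidean_space) mfd \<Rightarrow> ('i \<Rightarrow> 'e form_field) \<Rightarrow> real \<Rightarrow> bool" where
  "Ein_pos M g k \<longleftrightarrow>
     (\<forall>i\<in>charts M. \<forall>x\<in>chart_img M i. \<forall>u. u \<noteq> 0 \<longrightarrow> Ein_tensor k (g i) x u u > 0)"

definition Ein :: "('p, 'i, 'e::euclidean_space) mfd \<Rightarrow> ('i \<Rightarrow> 'e form_field) \<Rightarrow> ereal" where
  "Ein M g = (if Scal_pos M g
     then SUP k\<in>{k. 0 < k \<and> k < real DIM('e) \<and> Ein_pos M g k}. ereal k
     else 0)"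

definition ein :: "('p, 'i, 'e::euclidean_space) mfd \<Rightarrow> ('i \<Rightarrow> 'e form_field) \<Rightarrow> ereal" where
  "ein M g = (if Scal_pos M g
     then INF k\<in>{k. k < 0 \<and> Ein_pos M g k}. ereal k
     else 0)"

definition conformal_class ::
    "('p, 'i, 'e::euclidean_space) mfd \<Rightarrow> ('i \<Rightarrow> 'e form_field) \<Rightarrow> ('i \<Rightarrow> 'e form_field) set" where
  "conformal_class M g =
     {\<lambda>i x u v. exp (2 * f (chart_inv M i x)) * g i x u v | f. smooth_function M f}"

definition Ein_conf :: "('p, 'i, 'e::euclidean_space) mfd \<Rightarrow> ('i \<Rightarrow> 'e form_field) \<Rightarrow> ereal" where
  "Ein_conf M g = (SUP h\<in>conformal_class M g. Ein M h)"

definition ein_conf :: "('p, 'i, 'e::euclidean_space) mfd \<Rightarrow> ('i \<Rightarrow> 'e form_field) \<Rightarrow> ereal" where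
  "ein_conf M g = (INF h\<in>conformal_class M g. ein M h)"


section \<open>Space forms, spheres and products\<close>

text \<open>
  Completeness, part of the notion of a space form, is automatic for compact manifolds.
\<close>

definition compact_connected_space_form ::
    "real \<Rightarrow> ('p, 'i, 'e::euclidean_space) mfd \<Rightarrow> ('i \<Rightarrow> 'e form_field) \<Rightarrow> bool" where
  "compact_connected_space_form \<kappa> M g \<longleftrightarrow>
     smooth_manifold M \<and> riemannian_metric M g \<and>
     compact_space (points M) \<and> connected_space (points M) \<and> topspace (points M) \<noteq> {} \<and>
     (\<forall>i\<in>charts M. \<forall>x\<in>chart_img M i. \<forall>u v.
        u \<noteq> v \<and> independent {u, v} \<longrightarrow> sectional (g i) x u v = \<kappa>)"

text \<open>
  The unit sphere in \<open>'e \<times> real\<close>, of dimension \<open>DIM('e)\<close>, with its two stereographic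
  charts; the index \<open>s = 1\<close> or \<open>s = - 1\<close> is the last coordinate of the projection pole \<open>(0, s)\<close>.
\<close>

definition unit_sphere :: "('e::euclidean_space \<times> real, real, 'e) mfd" where
  "unit_sphere = \<lparr>
     points = top_of_set (sphere 0 1),
     charts = {1, - 1},
     chart_dom = (\<lambda>s. sphere 0 1 - {(0, s)}),
     chart = (\<lambda>s (y, t). y /\<^sub>R (1 - s * t)) \<rparr>"

text \<open>The metric induced by the Euclidean inner product of the ambient space.\<close>

definition round_metric :: "real \<Rightarrow> 'e::euclidean_space form_field" where
  "round_metric s x u v =
     frechet_derivative (chart_inv unit_sphere s) (at x) u \<bullet>
     frechet_derivative (chart_inv unit_sphere s) (at x) v"

definition product_mfd ::
    "('p, 'i, 'e) mfd \<Rightarrow> ('q, 'j, 'f) mfd \<Rightarrow> ('p \<times> 'q, 'i \<times> 'j, 'e \<times> 'f) mfd" where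
  "product_mfd M N = \<lparr>
     points = prod_topology (points M) (points N),
     charts = charts M \<times> charts N,
     chart_dom = (\<lambda>(i, j). chart_dom M i \<times> chart_dom N j),
     chart = (\<lambda>(i, j). map_prod (chart M i) (chart N j)) \<rparr>"

definition product_metric ::
    "('i \<Rightarrow> 'e form_field) \<Rightarrow> ('j \<Rightarrow> 'f form_field) \<Rightarrow> 'i \<times> 'j \<Rightarrow> ('e \<times> 'f) form_field" where
  "product_metric g h = (\<lambda>(i, j) (x, y) (u, u') (v, v'). g i x u v + h j y u' v')"

end

theory Submission
  imports Defs
begin

text \<open>
  For \<open>h = exp (2 * f) * g\<close> consider a minimum of \<open>f\<close>. There the conformal change of curvature
  involves only the Hessian of \<open>f\<close>, which is positive semidefinite: with \<open>p\<close> and \<open>q\<close> the dimensions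
  of the two factors, \<open>Ric h = Ric g - (p + q - 2) * Hess f - (\<Delta> f) * g\<close> and
  \<open>exp (2 * f) * Scal h = Scal g - 2 * (p + q - 1) * \<Delta> f\<close>. If \<open>Scal g = k * (p - 1)\<close> for some \<open>k > 0\<close>,
  then the \<open>g\<close>-trace of \<open>Ein_tensor k h\<close> over the spherical directions is a nonpositive combination of
  the partial Laplacians of \<open>f\<close>, so the tensor is not positive, and
  larger \<open>k\<close> reduce to this one by convexity since \<open>Scal h > 0\<close>; for \<open>k < 0\<close> with
  \<open>Scal g \<le> - k * (q - 1)\<close>, the trace over the hyperbolic directions is nonpositive likewise. Only the
  quadratic form of the Ricci tensor enters, so no symmetry of the curvature tensor is needed: on a
  space form it is read off from sectional curvature in an orthonormal basis.
\<close>

section \<open>Positive definite forms\<close>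

text \<open>The constants in the statement are the zeros in \<open>k\<close> of the two eigenvalues
  of \<open>Ein_tensor k g\<close> relative to \<open>g\<close>, namely
  \<open>Scal g - k * (p - 1)\<close> and \<open>Scal g + k * (q - 1)\<close>, where
  \<open>Scal g = (p - q) * (p + q - 1)\<close>. The bound on \<open>d\<close> says
  \<open>q < p\<close>, that is, \<open>Scal g > 0\<close>. For \<open>k > 0\<close> a single
  direction need not witness the failure of positivity: there the term
  \<open>k * (p + q - 2) * Hess f\<close> may outweigh the loss in the scalar curvature. Tracing
  over the \<open>p\<close> spherical directions spreads the Hessian term against \<open>p\<close>
  copies of that loss, and the comparison becomes
  \<open>k * (2 * p + q - 2) \<le> 2 * p * (p + q - 1)\<close>, which holds at the critical
  \<open>k\<close>. Curvature is given through derivatives in a chart of vectors defined by a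
  definite description. Before any curvature formula can be used, the Levi-Civita coefficients and
  the gradient must be shown to exist and to be differentiable at the point in question.\<close>

definition pos_form :: "('e::euclidean_space \<Rightarrow> 'e \<Rightarrow> real) \<Rightarrow> bool" where
  "pos_form b \<longleftrightarrow> bilinear b \<and> (\<forall>u v. b u v = b v u) \<and> (\<forall>u. u \<noteq> 0 \<longrightarrow> b u u > 0)"

lemma pos_formD:
  assumes "pos_form b"
  shows "bilinear b" and "b u v = b v u" and "u \<noteq> 0 \<Longrightarrow> b u u > 0"
  using assms unfolding pos_form_def by blast+

lemma bilinear_sum_scaleR_left:
  assumes "bilinear b"
  shows "b (\<Sum>i\<in>I. c i *\<^sub>R v i) w = (\<Sum>i\<in>I. c i *\<^sub>R b (v i) w)"
proof -
  have l: "linear (\<lambda>u. b u w)" using assms by (simp add: bilinear_def)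
  show ?thesis by (simp only: linear_sum[OF l] linear_cmul[OF l])
qed

lemma bilinear_sum_scaleR_right:
  assumes "bilinear b"
  shows "b w (\<Sum>i\<in>I. c i *\<^sub>R v i) = (\<Sum>i\<in>I. c i *\<^sub>R b w (v i))"
proof -
  have l: "linear (b w)" using assms by (simp add: bilinear_def)
  show ?thesis by (simp only: linear_sum[OF l] linear_cmul[OF l])
qed

lemma pos_form_eqI:
  assumes "pos_form b" "\<And>z. b w z = b w' z"
  shows "w = w'"
proof (rule ccontr)
  assume "w \<noteq> w'"
  then have "b (w - w') (w - w') > 0"
    using assms(1) by (simp add: pos_form_def)
  moreover have "b (w - w') (w - w') = 0"
    using assms(2) bilinear_lsub[OF pos_formD(1)[OF assms(1)]] by simp
  ultimately show False by simp
qed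

text \<open>The endomorphism whose matrix in the standard basis is the Gram matrix of
  \<open>b\<close>; it converts statements about \<open>b\<close> into statements about an
  invertible operator.\<close>

definition form_op :: "('e::euclidean_space \<Rightarrow> 'e \<Rightarrow> real) \<Rightarrow> 'e \<Rightarrow> 'e" where
  "form_op b u = (\<Sum>c\<in>Basis. b u c *\<^sub>R c)"

lemma linear_form_op:
  assumes "bilinear b"
  shows "linear (form_op b)"
  unfolding form_op_def
  by (rule linearI)
     (simp_all add: bilinear_ladd[OF assms] bilinear_lmul[OF assms] scaleR_add_left
       sum.distrib scaleR_sum_right)

lemma inner_form_op:
  assumes "bilinear b"
  shows "form_op b u \<bullet> z = b u z"
proof -
  have "b u z = b u (\<Sum>c\<in>Basis. (z \<bullet> c) *\<^sub>R c)"
    by (simp add: euclidean_representation)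
  also have "\<dots> = (\<Sum>c\<in>Basis. (z \<bullet> c) * b u c)"
    by (simp add: bilinear_sum_scaleR_right[OF assms])
  also have "\<dots> = form_op b u \<bullet> z"
    by (simp add: form_op_def inner_sum_left inner_commute[of z] mult.commute)
  finally show ?thesis by simp
qed

lemma bij_form_op:
  assumes "pos_form b"
  shows "bij (form_op b)"
proof -
  have bl: "bilinear b" using assms by (simp add: pos_form_def)
  have "inj (form_op b)"
    by (rule injI, rule pos_form_eqI[OF assms]) (metis inner_form_op[OF bl])
  with linear_injective_imp_surjective[OF linear_form_op[OF bl]]
  show ?thesis by (simp add: bij_def)
qed

text \<open>Riesz representation for \<open>b\<close> instead of the Euclidean inner product.
  Together with the uniqueness in \<open>pos_form_eqI\<close> it gives a meaning to the definite
  descriptions in the Christoffel symbols, the gradient and the scalar curvature.\<close>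

lemma pos_form_represent:
  assumes "pos_form b" "linear \<phi>"
  shows "\<exists>w. \<forall>z. b w z = \<phi> z"
proof -
  have bl: "bilinear b" using assms by (simp add: pos_form_def)
  obtain w where w: "form_op b w = (\<Sum>c\<in>Basis. \<phi> c *\<^sub>R c)"
    using bij_form_op[OF assms(1)] by (metis bij_def surjD)
  have "b w z = \<phi> z" for z
  proof -
    have "\<phi> z = \<phi> (\<Sum>c\<in>Basis. (z \<bullet> c) *\<^sub>R c)"
      by (simp add: euclidean_representation)
    also have "\<dots> = (\<Sum>c\<in>Basis. (z \<bullet> c) * \<phi> c)"
      by (simp add: linear_sum[OF assms(2)] linear_cmul[OF assms(2)])
    also have "\<dots> = form_op b w \<bullet> z"
      by (simp add: w inner_sum_left inner_commute[of z] mult.commute)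
    finally show ?thesis by (simp add: inner_form_op[OF bl])
  qed
  then show ?thesis by blast
qed

lemma the_represent:
  assumes "pos_form b" "\<And>z. b w z = \<phi> z"
  shows "(THE w. \<forall>z. b w z = \<phi> z) = w"
  by (rule the_equality) (auto intro: pos_form_eqI[OF assms(1)] simp: assms(2))

section \<open>Differentiability of the solution of a linear equation with variable
  coefficients\<close>

text \<open>A product rule in which one factor is merely continuous. The difference from
  \<open>r x *\<^sub>R E y\<close> is \<open>(r y - r x) *\<^sub>R E y\<close>, a factor tending to
  0 times one that is \<open>O(norm (y - x))\<close> because \<open>E x = 0\<close>.\<close>

lemma has_derivative_scaleR_vanishing:
  fixes E :: "'e::euclidean_space \<Rightarrow> 'b::real_normed_vector" and r :: "'e \<Rightarrow> real"
  assumes E: "(E has_derivative E') (at x)" and "E x = 0" and r: "isCont r x"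
  shows "((\<lambda>y. r y *\<^sub>R E y) has_derivative (\<lambda>v. r x *\<^sub>R E' v)) (at x)"
proof -
  have bl: "bounded_linear E'" using E by (rule has_derivative_bounded_linear)
  obtain K where K: "\<And>v. norm (E' v) \<le> norm v * K"
    using bounded_linear.bounded[OF bl] by blast
  have q: "((\<lambda>y. norm (E y - E' (y - x)) / norm (y - x)) \<longlongrightarrow> 0) (at x)"
    using E assms(2) by (simp add: has_derivative_iff_norm)
  have "((\<lambda>y. \<bar>r y - r x\<bar> * (K + norm (E y - E' (y - x)) / norm (y - x))) \<longlongrightarrow> 0 * (K + 0)) (at x)"
    using r q unfolding isCont_def
    by (intro tendsto_intros) (auto simp: LIM_zero_iff tendsto_rabs_zero_iff)
  then have lim: "((\<lambda>y. \<bar>r y - r x\<bar> * (K + norm (E y - E' (y - x)) / norm (y - x))) \<longlongrightarrow> 0) (at x)"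
    by simp
  have "((\<lambda>y. (r y - r x) *\<^sub>R E y) has_derivative (\<lambda>v. 0)) (at x)"
    unfolding has_derivative_iff_norm
  proof (intro conjI bounded_linear_zero tendsto_sandwich[OF _ _ tendsto_const lim])
    show "\<forall>\<^sub>F y in at x. norm ((r y - r x) *\<^sub>R E y - (r x - r x) *\<^sub>R E x - 0) / norm (y - x)
        \<le> \<bar>r y - r x\<bar> * (K + norm (E y - E' (y - x)) / norm (y - x))"
      unfolding eventually_at_filter
    proof (rule always_eventually, intro allI impI)
      fix y assume "y \<noteq> x"
      have "norm (E y) \<le> norm (E' (y - x)) + norm (E y - E' (y - x))"
        by (metis add.commute diff_add_cancel norm_triangle_ineq)
      also have "\<dots> \<le> norm (y - x) * K + norm (E y - E' (y - x))"
        using K by simp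
      finally have "norm (E y) / norm (y - x) \<le> K + norm (E y - E' (y - x)) / norm (y - x)"
        using \<open>y \<noteq> x\<close> by (simp add: field_simps)
      then have "\<bar>r y - r x\<bar> * (norm (E y) / norm (y - x))
          \<le> \<bar>r y - r x\<bar> * (K + norm (E y - E' (y - x)) / norm (y - x))"
        by (rule mult_left_mono) simp
      then show "norm ((r y - r x) *\<^sub>R E y - (r x - r x) *\<^sub>R E x - 0) / norm (y - x)
        \<le> \<bar>r y - r x\<bar> * (K + norm (E y - E' (y - x)) / norm (y - x))"
        by simp
    qed
  qed simp
  moreover have "((\<lambda>y. r x *\<^sub>R E y) has_derivative (\<lambda>v. r x *\<^sub>R E' v)) (at x)"
    using E by (rule has_derivative_scaleR_right)
  ultimately have "((\<lambda>y. (r y - r x) *\<^sub>R E y + r x *\<^sub>R E y) has_derivative (\<lambda>v. 0 + r x *\<^sub>R E' v)) (at x)"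
    by (rule has_derivative_add)
  then show ?thesis by (simp add: algebra_simps)
qed

text \<open>With \<open>K\<close> inverse to the form at \<open>x\<close>, the solution satisfies
  \<open>w y = K (\<phi> y) - K ((H y - H x) (w y))\<close>; this bounds \<open>w\<close> near \<open>x\<close>, then makes it
  continuous and then differentiable at \<open>x\<close>.\<close>

lemma differentiable_represent:
  fixes H :: "'e::euclidean_space \<Rightarrow> 'e \<Rightarrow> 'e \<Rightarrow> real"
  assumes U: "open U" "x \<in> U"
    and pos: "\<And>y. y \<in> U \<Longrightarrow> pos_form (H y)"
    and dH: "\<And>u v. (\<lambda>y. H y u v) differentiable (at x)"
    and w: "\<And>y z. y \<in> U \<Longrightarrow> H y (w y) z = \<phi> y z"
    and d\<phi>: "\<And>z. (\<lambda>y. \<phi> y z) differentiable (at x)"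
  shows "w differentiable (at x)"
proof -
  have bl: "bilinear (H y)" if "y \<in> U" for y
    using pos[OF that] by (simp add: pos_form_def)
  define A where "A y = form_op (H y)" for y
  have linA: "linear (A y)" if "y \<in> U" for y
    unfolding A_def by (rule linear_form_op[OF bl[OF that]])
  have bijA: "bij (A x)"
    unfolding A_def by (rule bij_form_op[OF pos[OF \<open>x \<in> U\<close>]])
  define K where "K = inv (A x)"
  have K: "K (A x u) = u" for u
    unfolding K_def using bijA by (simp add: bij_def)
  have linK: "linear K"
    unfolding K_def using linA[OF \<open>x \<in> U\<close>] bijA by (intro inj_linear_imp_inv_linear) (auto simp: bij_def)
  then have blK: "bounded_linear K"
    by (simp add: linear_conv_bounded_linear)
  define \<Phi> where "\<Phi> y = K (\<Sum>c\<in>Basis. \<phi> y c *\<^sub>R c)" for y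
  define E where "E c y = K (A y c - A x c)" for c y
  have d\<Phi>: "\<Phi> differentiable (at x)"
    unfolding \<Phi>_def
    by (intro differentiable_compose[OF bounded_linear_imp_differentiable[OF blK]]
        differentiable_sum ballI differentiable_scaleR d\<phi>) auto
  have dE: "E c differentiable (at x)" for c
    unfolding E_def A_def form_op_def
    by (intro differentiable_compose[OF bounded_linear_imp_differentiable[OF blK]]
        differentiable_sum ballI differentiable_diff differentiable_scaleR dH) auto
  have E0: "E c x = 0" for c
    using linear_0[OF linK] by (simp add: E_def)
  have eq: "w y = \<Phi> y - (\<Sum>c\<in>Basis. (w y \<bullet> c) *\<^sub>R E c y)" if "y \<in> U" for y
  proof -
    have "A y (w y) = (\<Sum>c\<in>Basis. \<phi> y c *\<^sub>R c)"
      using w[OF that] by (simp add: A_def form_op_def)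
    then have 1: "\<Phi> y = K (A y (w y))" by (simp add: \<Phi>_def)
    have ex: "L (w y) = (\<Sum>c\<in>Basis. (w y \<bullet> c) *\<^sub>R L c)" if "linear L" for L :: "'e \<Rightarrow> 'e"
      using linear_sum[OF that, of "\<lambda>c. (w y \<bullet> c) *\<^sub>R c" Basis] linear_cmul[OF that]
      by (simp add: euclidean_representation)
    have "(\<Sum>c\<in>Basis. (w y \<bullet> c) *\<^sub>R E c y) = (\<Sum>c\<in>Basis. (w y \<bullet> c) *\<^sub>R K (A y c))
        - (\<Sum>c\<in>Basis. (w y \<bullet> c) *\<^sub>R K (A x c))"
      by (simp add: E_def linear_diff[OF linK] scaleR_diff_right sum_subtractf)
    also have "\<dots> = K (A y (w y)) - K (A x (w y))"
      using ex[OF linear_compose[OF linA[OF that] linK]]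
        ex[OF linear_compose[OF linA[OF \<open>x \<in> U\<close>] linK]] by (simp add: o_def)
    finally show ?thesis using 1 K by simp
  qed
  have evU: "\<forall>\<^sub>F y in at x. y \<in> U"
    using U by (rule eventually_at_in_open')
  have E_lim: "((\<lambda>y. E c y) \<longlongrightarrow> 0) (at x)" for c
    using differentiable_imp_continuous_within[OF dE[of c]] E0[of c] by (simp add: continuous_at)
  have \<Phi>_lim: "(\<Phi> \<longlongrightarrow> \<Phi> x) (at x)"
    using differentiable_imp_continuous_within[OF d\<Phi>] by (simp add: continuous_at)
  have "((\<lambda>y. \<Sum>c\<in>Basis. norm (E c y)) \<longlongrightarrow> (\<Sum>c\<in>(Basis :: 'e set). norm (0 :: 'e))) (at x)"
    by (intro tendsto_intros E_lim)
  then have "((\<lambda>y. \<Sum>c\<in>Basis. norm (E c y)) \<longlongrightarrow> 0) (at x)" by simp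
  \<comment> \<open>With the threshold 1/2 the correction term is at most half of
    \<open>norm (w y)\<close> and can be absorbed on the left, whence the factor 2 in
    \<open>C\<close>.\<close>
  then have ev1: "\<forall>\<^sub>F y in at x. (\<Sum>c\<in>Basis. norm (E c y)) < 1/2"
    by (rule order_tendstoD) simp
  have ev2: "\<forall>\<^sub>F y in at x. norm (\<Phi> y) < norm (\<Phi> x) + 1"
    by (rule order_tendstoD[OF tendsto_norm[OF \<Phi>_lim]]) simp
  define C where "C = 2 * (norm (\<Phi> x) + 1)"
  have ev3: "\<forall>\<^sub>F y in at x. norm (w y) \<le> C"
    using evU ev1 ev2
  proof eventually_elim
    case (elim y)
    have "norm (w y) \<le> norm (\<Phi> y) + norm (\<Sum>c\<in>Basis. (w y \<bullet> c) *\<^sub>R E c y)"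
      using eq[OF elim(1)] norm_triangle_ineq4 by metis
    also have "norm (\<Sum>c\<in>Basis. (w y \<bullet> c) *\<^sub>R E c y) \<le> (\<Sum>c\<in>Basis. norm (w y) * norm (E c y))"
      by (rule sum_norm_le) (simp add: mult_right_mono Basis_le_norm)
    also have "\<dots> = norm (w y) * (\<Sum>c\<in>Basis. norm (E c y))"
      by (simp add: sum_distrib_left)
    also have "\<dots> \<le> norm (w y) * (1/2)"
      using elim(2) by (intro mult_left_mono) auto
    finally show ?case using elim(3) by (simp add: C_def)
  qed
  have "((\<lambda>y. (w y \<bullet> c) *\<^sub>R E c y) \<longlongrightarrow> 0) (at x)" if "c \<in> Basis" for c
  proof (rule Lim_null_comparison)
    show "\<forall>\<^sub>F y in at x. norm ((w y \<bullet> c) *\<^sub>R E c y) \<le> C * norm (E c y)"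
      using ev3 by eventually_elim
        (simp, meson Basis_le_norm that mult_right_mono norm_ge_zero order_trans)
    show "((\<lambda>y. C * norm (E c y)) \<longlongrightarrow> 0) (at x)"
      using tendsto_mult_right_zero[OF tendsto_norm_zero[OF E_lim]] .
  qed
  then have "((\<lambda>y. \<Phi> y - (\<Sum>c\<in>Basis. (w y \<bullet> c) *\<^sub>R E c y)) \<longlongrightarrow> \<Phi> x - (\<Sum>c\<in>(Basis :: 'e set). 0)) (at x)"
    by (intro tendsto_diff tendsto_sum \<Phi>_lim) auto
  moreover have "\<Phi> x - (\<Sum>c\<in>(Basis :: 'e set). 0) = w x"
    using eq[OF \<open>x \<in> U\<close>] E0 by simp
  ultimately have "((\<lambda>y. \<Phi> y - (\<Sum>c\<in>Basis. (w y \<bullet> c) *\<^sub>R E c y)) \<longlongrightarrow> w x) (at x)" by simp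
  then have "(w \<longlongrightarrow> w x) (at x)"
    by (rule Lim_transform_eventually) (use evU eq in \<open>auto elim!: eventually_mono\<close>)
  then have cont: "isCont w x" by (simp add: isCont_def)
  \<comment> \<open>So far \<open>w\<close> is only known to be continuous at \<open>x\<close>; that
    is enough because each \<open>E c\<close> vanishes there.\<close>
  have "(\<lambda>y. (w y \<bullet> c) *\<^sub>R E c y) differentiable (at x)" for c
  proof -
    have c: "isCont (\<lambda>y. w y \<bullet> c) x" using cont by (intro continuous_intros)
    obtain E' where E': "(E c has_derivative E') (at x)"
      using dE unfolding differentiable_def by blast
    show ?thesis
      using has_derivative_scaleR_vanishing[where E = "E c", OF E' E0 c]
      unfolding differentiable_def by blast
  qed
  then have "(\<lambda>y. \<Phi> y - (\<Sum>c\<in>Basis. (w y \<bullet> c) *\<^sub>R E c y)) differentiable (at x)"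
    by (intro differentiable_diff differentiable_sum d\<Phi>) auto
  then obtain D where "((\<lambda>y. \<Phi> y - (\<Sum>c\<in>Basis. (w y \<bullet> c) *\<^sub>R E c y)) has_derivative D) (at x)"
    by (auto simp: differentiable_def)
  then have "(w has_derivative D) (at x)"
    by (rule has_derivative_transform_within_open[OF _ U]) (use eq in simp)
  then show ?thesis by (auto simp: differentiable_def)
qed

section \<open>Orthonormal bases and traces\<close>

text \<open>Spanning is encoded by the expansion formula, which is the form in which traces and
  inner products consume it.\<close>

definition onb :: "('e::euclidean_space \<Rightarrow> 'e \<Rightarrow> real) \<Rightarrow> 'e set \<Rightarrow> bool" where
  "onb b B \<longleftrightarrow> finite B \<and> (\<forall>e\<in>B. \<forall>e'\<in>B. b e e' = (if e = e' then 1 else 0)) \<and>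
     (\<forall>v. v = (\<Sum>e\<in>B. b v e *\<^sub>R e))"

lemma onbD:
  assumes "onb b B"
  shows "finite B" and "e \<in> B \<Longrightarrow> b e e = 1" and "v = (\<Sum>e\<in>B. b v e *\<^sub>R e)"
  using assms unfolding onb_def by (blast | simp)+

text \<open>An orthonormal family of maximal size works: sizes are bounded by linear independence,
  and a vector that the family fails to expand would leave a nonzero residual that can be normalised
  and added.\<close>

lemma onb_exists:
  assumes "pos_form b"
  shows "\<exists>B. onb b B"
proof -
  have bl: "bilinear b" using assms by (simp add: pos_form_def)
  define P where "P B \<longleftrightarrow> finite B \<and> (\<forall>e\<in>B. \<forall>e'\<in>B. b e e' = (if e = e' then 1 else 0))" for B
  have coeff: "b (\<Sum>e\<in>B. c e *\<^sub>R e) e' = c e'" if "P B" "e' \<in> B" for B c e'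
  proof -
    have "b (\<Sum>e\<in>B. c e *\<^sub>R e) e' = (\<Sum>e\<in>B. c e * (if e = e' then 1 else 0))"
      using that by (auto simp: bilinear_sum_scaleR_left[OF bl] P_def intro!: sum.cong)
    then show ?thesis using that by (simp add: P_def if_distrib cong: if_cong)
  qed
  have "card B < Suc DIM('a)" if "P B" for B
  proof -
    have "independent B"
      unfolding independent_explicit
    proof (intro conjI allI impI ballI)
      show "finite B" using that by (simp add: P_def)
      fix c e assume "(\<Sum>v\<in>B. c v *\<^sub>R v) = 0" "e \<in> B"
      then show "c e = 0" using coeff[OF that, of e c] bilinear_lzero[OF bl, of e] by simp
    qed
    then show ?thesis using independent_bound by fastforce
  qed
  moreover have "P {}" by (simp add: P_def)
  ultimately obtain B where B: "P B" and max: "\<And>B'. P B' \<Longrightarrow> card B' \<le> card B"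
    using ex_has_greatest_nat[of P "{}" card "Suc DIM('a)"] by blast
  have expand: "v = (\<Sum>e\<in>B. b v e *\<^sub>R e)" for v
  proof (rule ccontr)
    define w where "w = v - (\<Sum>e\<in>B. b v e *\<^sub>R e)"
    assume "v \<noteq> (\<Sum>e\<in>B. b v e *\<^sub>R e)"
    then have "w \<noteq> 0" by (simp add: w_def)
    then have pos: "b w w > 0" using assms by (simp add: pos_form_def)
    have orth: "b w e = 0" if "e \<in> B" for e
      using coeff[OF B that, of "b v"] by (simp add: w_def bilinear_lsub[OF bl])
    define e0 where "e0 = (1 / sqrt (b w w)) *\<^sub>R w"
    have e0: "b e0 e0 = 1"
      using pos by (simp add: e0_def bilinear_lmul[OF bl] bilinear_rmul[OF bl] field_simps)
    have e0_orth: "b e0 e = 0" "b e e0 = 0" if "e \<in> B" for e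
      using orth[OF that] pos_formD(2)[OF assms, of w e]
      by (simp_all add: e0_def bilinear_lmul[OF bl] bilinear_rmul[OF bl])
    have "e0 \<notin> B" using e0 e0_orth by force
    moreover have "P (insert e0 B)"
      using B e0 e0_orth \<open>e0 \<notin> B\<close> by (auto simp: P_def)
    ultimately show False using max[of "insert e0 B"] B by (simp add: P_def)
  qed
  show ?thesis unfolding onb_def using B[unfolded P_def] expand by blast
qed

lemma endo_trace_onb:
  assumes "pos_form b" "onb b B" "linear L"
  shows "endo_trace L = (\<Sum>e\<in>B. b (L e) e)"
proof -
  have bl: "bilinear b" using assms by (simp add: pos_form_def)
  have L: "L c = (\<Sum>e\<in>B. b c e *\<^sub>R L e)" for c
  proof -
    have "L c = L (\<Sum>e\<in>B. b c e *\<^sub>R e)"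
      using onbD(3)[OF assms(2), of c] by (rule arg_cong)
    also have "\<dots> = (\<Sum>e\<in>B. b c e *\<^sub>R L e)"
      by (simp add: linear_sum[OF assms(3)] linear_cmul[OF assms(3)])
    finally show ?thesis .
  qed
  have "endo_trace L = (\<Sum>c\<in>Basis. (\<Sum>e\<in>B. b c e *\<^sub>R L e) \<bullet> c)"
    unfolding endo_trace_def by (rule sum.cong[OF refl], subst L, rule refl)
  also have "\<dots> = (\<Sum>e\<in>B. \<Sum>c\<in>Basis. (L e \<bullet> c) * b c e)"
    unfolding inner_sum_left by (subst sum.swap) (simp add: mult.commute)
  also have "\<dots> = (\<Sum>e\<in>B. b (\<Sum>c\<in>Basis. (L e \<bullet> c) *\<^sub>R c) e)"
    by (simp add: bilinear_sum_scaleR_left[OF bl])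
  finally show ?thesis by (simp add: euclidean_representation)
qed

text \<open>The trace of the identity, computed in \<open>B\<close> and in the standard
  basis.\<close>

lemma card_onb:
  fixes b :: "'e::euclidean_space \<Rightarrow> 'e \<Rightarrow> real"
  assumes "pos_form b" "onb b B"
  shows "card B = DIM('e)"
proof -
  have "endo_trace (\<lambda>u :: 'e. u) = real (card B)"
    using endo_trace_onb[OF assms linear_id[unfolded id_def]] onbD(2)[OF assms(2)] by simp
  then show ?thesis by (simp add: endo_trace_def inner_Basis)
qed

lemma onb_parseval:
  assumes "pos_form b" "onb b B"
  shows "(\<Sum>e\<in>B. b u e * b v e) = b u v"
proof -
  have bl: "bilinear b" using assms by (simp add: pos_form_def)
  have "b u v = b u (\<Sum>e\<in>B. b v e *\<^sub>R e)" using onbD(3)[OF assms(2), of v] by (rule arg_cong)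
  then show ?thesis
    by (simp add: bilinear_sum_scaleR_right[OF bl] mult.commute)
qed

section \<open>Levi-Civita connection and curvature\<close>

abbreviation dd :: "('e::euclidean_space \<Rightarrow> 'b::real_normed_vector) \<Rightarrow> 'e \<Rightarrow> 'e \<Rightarrow> 'b" where
  "dd f x \<equiv> frechet_derivative f (at x)"

lemma dd_eqI: "(f has_derivative f') (at x) \<Longrightarrow> dd f x = f'"
  by (rule frechet_derivative_at[symmetric])

lemma dd_works: "f differentiable (at x) \<Longrightarrow> (f has_derivative dd f x) (at x)"
  by (simp add: frechet_derivative_works)

text \<open>\<open>frechet_derivative\<close> is a choice from the set of derivatives, and functions
  that agree near \<open>x\<close> have the same set.\<close>

lemma dd_cong:
  assumes "open U" "x \<in> U" "\<And>y. y \<in> U \<Longrightarrow> f y = f' y"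
  shows "dd f x = dd f' x"
proof -
  have "(f has_derivative D) (at x) \<longleftrightarrow> (f' has_derivative D) (at x)" for D
    using has_derivative_transform_within_open[OF _ assms(1,2), of f D UNIV f']
      has_derivative_transform_within_open[OF _ assms(1,2), of f' D UNIV f] assms(3) by auto
  then show ?thesis by (simp add: frechet_derivative_def)
qed

lemma linear_dd_family:
  assumes U: "open U" "x \<in> U" and lin: "\<And>y. y \<in> U \<Longrightarrow> linear (\<Phi> y)"
    and d: "\<And>u. (\<lambda>y. \<Phi> y u) differentiable (at x)"
  shows "linear (\<lambda>u. dd (\<lambda>y. \<Phi> y u) x v)"
proof (rule linearI)
  fix a b
  have "dd (\<lambda>y. \<Phi> y (a + b)) x = dd (\<lambda>y. \<Phi> y a + \<Phi> y b) x"
    by (rule dd_cong[OF U]) (simp add: linear_add[OF lin])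
  also have "\<dots> = (\<lambda>v. dd (\<lambda>y. \<Phi> y a) x v + dd (\<lambda>y. \<Phi> y b) x v)"
    by (intro dd_eqI has_derivative_add dd_works d)
  finally show "dd (\<lambda>y. \<Phi> y (a + b)) x v = dd (\<lambda>y. \<Phi> y a) x v + dd (\<lambda>y. \<Phi> y b) x v" by simp
next
  fix r a
  have "dd (\<lambda>y. \<Phi> y (r *\<^sub>R a)) x = dd (\<lambda>y. r *\<^sub>R \<Phi> y a) x"
    by (rule dd_cong[OF U]) (simp add: linear_cmul[OF lin])
  also have "\<dots> = (\<lambda>v. r *\<^sub>R dd (\<lambda>y. \<Phi> y a) x v)"
    by (intro dd_eqI has_derivative_scaleR_right dd_works d)
  finally show "dd (\<lambda>y. \<Phi> y (r *\<^sub>R a)) x v = r *\<^sub>R dd (\<lambda>y. \<Phi> y a) x v" by simp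
qed

section \<open>Curvature and Ricci tensor from connection coefficients\<close>

text \<open>The curvature expression for arbitrary connection coefficients \<open>G\<close>. Its
  algebraic properties follow from \<open>conn_at\<close> alone, so explicit coefficients of
  different metrics can be inserted.\<close>

definition curv :: "('e::euclidean_space \<Rightarrow> 'e \<Rightarrow> 'e \<Rightarrow> 'e) \<Rightarrow> 'e \<Rightarrow> 'e \<Rightarrow> 'e \<Rightarrow> 'e \<Rightarrow> 'e" where
  "curv G x u v w = dd (\<lambda>y. G y v w) x u - dd (\<lambda>y. G y u w) x v + G x u (G x v w) - G x v (G x u w)"

lemma riemann_eq_curv: "riemann h x u v w = curv (christoffel h) x u v w"
  by (simp add: riemann_def curv_def)

text \<open>Bilinearity is asked on a neighbourhood, since it has to survive differentiation in the
  base point; differentiability only where curvature is evaluated.\<close>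

definition conn_at :: "'e::euclidean_space set \<Rightarrow> ('e \<Rightarrow> 'e \<Rightarrow> 'e \<Rightarrow> 'e) \<Rightarrow> 'e \<Rightarrow> bool" where
  "conn_at U G x \<longleftrightarrow> open U \<and> x \<in> U \<and> (\<forall>y\<in>U. bilinear (G y)) \<and>
     (\<forall>u v. (\<lambda>y. G y u v) differentiable (at x))"

lemma curv_linear:
  assumes "conn_at U G x"
  shows "linear (\<lambda>u. curv G x u v w)" "linear (\<lambda>v. curv G x u v w)" "linear (\<lambda>w. curv G x u v w)"
proof -
  have U: "open U" "x \<in> U" using assms by (auto simp: conn_at_def)
  have bl: "linear (G y u)" "linear (\<lambda>u. G y u v)" if "y \<in> U" for y u v
    using assms that by (auto simp: conn_at_def bilinear_def)
  have d: "(\<lambda>y. G y u v) differentiable (at x)" for u v using assms by (simp add: conn_at_def)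
  have 1: "linear (\<lambda>u. dd (\<lambda>y. G y u w) x v)" for v w
    by (rule linear_dd_family[OF U]) (use bl d in auto)
  have 2: "linear (\<lambda>w. dd (\<lambda>y. G y u w) x v)" for u v
    by (rule linear_dd_family[OF U]) (use bl d in auto)
  have 3: "linear (dd (\<lambda>y. G y v w) x)" for v w
    by (rule linear_frechet_derivative[OF d])
  have 4: "linear (\<lambda>u. G x v (G x u w))" for v w
    using linear_compose[OF bl(2) bl(1), OF U(2) U(2), of v w] by (simp add: o_def)
  have 5: "linear (\<lambda>w. G x u (G x v w))" for u v
    using linear_compose[OF bl(1) bl(1), OF U(2) U(2), of u v] by (simp add: o_def)
  show *: "linear (\<lambda>u. curv G x u v w)" for v w
    unfolding curv_def
    by (intro linear_compose_add linear_compose_sub 1 3 4 bl(2) U)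
  \<comment> \<open>Antisymmetry carries linearity from the first argument to the second.\<close>
  have "curv G x u v w = - curv G x v u w" for v by (simp add: curv_def)
  then show "linear (\<lambda>v. curv G x u v w)"
    using linear_compose_neg[OF *[of u w]] by presburger
  show "linear (\<lambda>w. curv G x u v w)"
    unfolding curv_def
    by (intro linear_compose_add linear_compose_sub 2 5)
qed

lemma endo_trace_add: "endo_trace (\<lambda>u. A u + B u) = endo_trace A + endo_trace B"
  by (simp add: endo_trace_def inner_add_left sum.distrib)

lemma endo_trace_diff: "endo_trace (\<lambda>u. A u - B u) = endo_trace A - endo_trace B"
  by (simp add: endo_trace_def inner_diff_left sum_subtractf)

lemma endo_trace_scaleR: "endo_trace (\<lambda>u. c *\<^sub>R A u) = c * endo_trace A"
  by (simp add: endo_trace_def sum_distrib_left)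

lemma endo_trace_id: "endo_trace (\<lambda>u :: 'e::euclidean_space. u) = DIM('e)"
  by (simp add: endo_trace_def inner_Basis)

text \<open>Evaluates the curvature terms in which the traced vector enters only through a scalar
  coefficient.\<close>

lemma endo_trace_rank_one:
  assumes "linear \<phi>"
  shows "endo_trace (\<lambda>u. \<phi> u *\<^sub>R a) = \<phi> a"
proof -
  have "\<phi> a = \<phi> (\<Sum>c\<in>Basis. (a \<bullet> c) *\<^sub>R c)" by (simp add: euclidean_representation)
  also have "\<dots> = (\<Sum>c\<in>Basis. (a \<bullet> c) * \<phi> c)"
    by (simp add: linear_sum[OF assms] linear_cmul[OF assms])
  finally show ?thesis by (simp add: endo_trace_def mult.commute)
qed

lemma bilinear_Ric:
  assumes "conn_at U (christoffel h) x"
  shows "bilinear (Ric h x)"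
  unfolding bilinear_def Ric_def riemann_eq_curv
  by (intro conjI allI linearI)
     (simp_all add: linear_add[OF curv_linear(2)[OF assms]] linear_add[OF curv_linear(3)[OF assms]]
       linear_cmul[OF curv_linear(2)[OF assms]] linear_cmul[OF curv_linear(3)[OF assms]]
       endo_trace_add endo_trace_scaleR)

text \<open>The factor \<open>c\<close> allows the scalar curvature of a rescaled metric to be
  traced in a basis orthonormal for the original one; later \<open>c\<close> is
  \<open>exp (2 * F x)\<close>.\<close>

lemma Scal_onb:
  assumes "pos_form b" "onb b B" and h: "h x = (\<lambda>u v. c * b u v)" and "c > 0"
    and Ric: "bilinear (Ric h x)"
  shows "c * Scal h x = (\<Sum>e\<in>B. Ric h x e e)"
proof -
  have bl: "bilinear b" using assms(1) by (rule pos_formD)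
  have rl: "linear (Ric h x u)" for u using Ric by (simp add: bilinear_def)
  define L where "L u = (THE w. \<forall>z. h x w z = Ric h x u z)" for u
  have pos: "pos_form (h x)"
    using assms(1,4) bilinear_ladd[OF bl] bilinear_radd[OF bl] bilinear_lmul[OF bl] bilinear_rmul[OF bl]
    unfolding pos_form_def h
    by (auto simp: bilinear_def algebra_simps intro!: linearI)
  have L: "c * b (L u) z = Ric h x u z" for u z
  proof -
    obtain w where w: "\<And>z. h x w z = Ric h x u z"
      using pos_form_represent[OF pos rl[of u]] by blast
    then have "L u = w" unfolding L_def by (rule the_represent[OF pos])
    then show ?thesis using w[of z] by (simp add: h)
  qed
  then have L': "b (L u) z = Ric h x u z / c" for u z
    using \<open>c > 0\<close> by (simp add: field_simps)
  have "linear L"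
    by (rule linearI; rule pos_form_eqI[OF assms(1)])
       (simp_all add: L' bilinear_ladd[OF bl] bilinear_lmul[OF bl] add_divide_distrib
        bilinear_ladd[OF Ric] bilinear_lmul[OF Ric])
  then have "endo_trace L = (\<Sum>e\<in>B. b (L e) e)"
    by (rule endo_trace_onb[OF assms(1,2)])
  then show ?thesis
    by (simp add: Scal_def L_def[symmetric] sum_distrib_left L)
qed

section \<open>The Levi-Civita connection from the Koszul formula\<close>

definition metric_on :: "'e::euclidean_space set \<Rightarrow> 'e form_field \<Rightarrow> bool" where
  "metric_on U h \<longleftrightarrow> open U \<and> (\<forall>x\<in>U. pos_form (h x) \<and> (\<forall>u v. (\<lambda>y. h y u v) differentiable (at x)))"

definition koszul :: "'e::euclidean_space form_field \<Rightarrow> 'e \<Rightarrow> 'e \<Rightarrow> 'e \<Rightarrow> 'e \<Rightarrow> real" where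
  "koszul h x u v z =
     (dd (\<lambda>y. h y v z) x u + dd (\<lambda>y. h y u z) x v - dd (\<lambda>y. h y u v) x z) / 2"

lemma christoffel_eqI:
  assumes "pos_form (h x)" "\<And>z. h x w z = koszul h x u v z"
  shows "christoffel h x u v = w"
  unfolding christoffel_def using assms by (intro the_represent) (auto simp: koszul_def)

lemma linear_koszul:
  assumes "metric_on U h" "x \<in> U"
  shows "linear (\<lambda>u. koszul h x u v z)" "linear (\<lambda>v. koszul h x u v z)" "linear (\<lambda>z. koszul h x u v z)"
proof -
  have U: "open U" "x \<in> U" and d: "\<And>u v. (\<lambda>y. h y u v) differentiable (at x)"
    using assms by (auto simp: metric_on_def)
  have bl: "linear (h y u)" "linear (\<lambda>u. h y u v)" if "y \<in> U" for y u v
    using assms that by (auto simp: metric_on_def pos_form_def bilinear_def)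
  have 1: "linear (\<lambda>u. dd (\<lambda>y. h y u w) x v)" for v w
    by (rule linear_dd_family[OF U]) (use bl d in auto)
  have 2: "linear (\<lambda>w. dd (\<lambda>y. h y u w) x v)" for u v
    by (rule linear_dd_family[OF U]) (use bl d in auto)
  have 3: "linear (dd (\<lambda>y. h y v w) x)" for v w
    by (rule linear_frechet_derivative[OF d])
  have half: "linear (\<lambda>u. f u / 2)" if "linear f" for f :: "'a \<Rightarrow> real"
    using that by (simp add: linear_iff add_divide_distrib)
  show "linear (\<lambda>u. koszul h x u v z)" "linear (\<lambda>v. koszul h x u v z)" "linear (\<lambda>z. koszul h x u v z)"
    unfolding koszul_def
    by (intro half linear_compose_add linear_compose_sub 1 2 3)+
qed

lemma christoffel_koszul:
  assumes "metric_on U h" "x \<in> U"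
  shows "h x (christoffel h x u v) z = koszul h x u v z"
proof -
  have pos: "pos_form (h x)" using assms by (auto simp: metric_on_def)
  obtain w where w: "\<And>z. h x w z = koszul h x u v z"
    using pos_form_represent[OF pos linear_koszul(3)[OF assms]] by metis
  then have "christoffel h x u v = w" by (rule christoffel_eqI[where h = h, OF pos])
  with w show ?thesis by simp
qed

lemma bilinear_christoffel:
  assumes "metric_on U h" "x \<in> U"
  shows "bilinear (christoffel h x)"
proof -
  have pos: "pos_form (h x)" using assms by (auto simp: metric_on_def)
  note bl = pos_formD(1)[OF pos] and k = christoffel_koszul[OF assms]
  show ?thesis
    unfolding bilinear_def
    by (intro conjI allI linearI; rule pos_form_eqI[OF pos];
      simp add: bilinear_ladd[OF bl] bilinear_lmul[OF bl] k
        linear_add[OF linear_koszul(1)[OF assms]] linear_add[OF linear_koszul(2)[OF assms]]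
        linear_cmul[OF linear_koszul(1)[OF assms]] linear_cmul[OF linear_koszul(2)[OF assms]])
qed

text \<open>The Christoffel vector solves a linear equation whose coefficients and right-hand side
  are differentiable at \<open>x\<close>, so \<open>differentiable_represent\<close>
  applies.\<close>

lemma conn_at_christoffel:
  assumes "metric_on U h" "x \<in> U"
    and d2: "\<And>u v w. (\<lambda>y. dd (\<lambda>z. h z u v) y w) differentiable (at x)"
  shows "conn_at U (christoffel h) x"
proof -
  have "(\<lambda>y. christoffel h y u v) differentiable (at x)" for u v
  proof (rule differentiable_represent)
    show "open U" "x \<in> U" "\<And>y. y \<in> U \<Longrightarrow> pos_form (h y)" "\<And>u v. (\<lambda>y. h y u v) differentiable (at x)"
      using assms by (auto simp: metric_on_def)
    show "\<And>y z. y \<in> U \<Longrightarrow> h y (christoffel h y u v) z = koszul h y u v z"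
      by (rule christoffel_koszul[OF assms(1)])
    show "(\<lambda>y. koszul h y u v z) differentiable (at x)" for z
      unfolding koszul_def divide_inverse
      by (intro differentiable_mult differentiable_add differentiable_diff d2) simp
  qed
  then show ?thesis
    using assms bilinear_christoffel[OF assms(1)] by (auto simp: conn_at_def metric_on_def)
qed

section \<open>Conformal change at a critical point of the conformal factor\<close>

definition conf :: "('e \<Rightarrow> real) \<Rightarrow> 'e form_field \<Rightarrow> 'e form_field" where
  "conf F g = (\<lambda>x u v. exp (2 * F x) * g x u v)"

lemma metric_on_conf:
  assumes "metric_on U g" "\<And>x. x \<in> U \<Longrightarrow> F differentiable (at x)"
  shows "metric_on U (conf F g)"
proof -
  have "pos_form (conf F g x)" if "x \<in> U" for x
  proof -
    have pos: "pos_form (g x)" using assms that by (auto simp: metric_on_def)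
    note bl = pos_formD(1)[OF pos]
    show ?thesis
      using pos bilinear_ladd[OF bl] bilinear_radd[OF bl] bilinear_lmul[OF bl] bilinear_rmul[OF bl]
      unfolding pos_form_def conf_def
      by (auto simp: bilinear_def algebra_simps intro!: linearI)
  qed
  moreover have "(\<lambda>x. exp (2 * F x)) differentiable (at x)" if "x \<in> U" for x
  proof -
    have "exp differentiable (at (2 * F x))"
      using DERIV_exp[of "2 * F x"] by (auto simp: has_field_derivative_def differentiable_def)
    then show ?thesis
      by (rule differentiable_compose) (use assms(2)[OF that] in simp)
  qed
  ultimately show ?thesis
    using assms by (auto simp: metric_on_def conf_def intro!: differentiable_mult)
qed

definition grad :: "'e::euclidean_space form_field \<Rightarrow> ('e \<Rightarrow> real) \<Rightarrow> 'e \<Rightarrow> 'e" where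
  "grad g F x = (THE w. \<forall>z. g x w z = dd F x z)"

lemma grad_eq:
  assumes "pos_form (g x)" "F differentiable (at x)"
  shows "g x (grad g F x) z = dd F x z"
proof -
  obtain w where w: "\<And>z. g x w z = dd F x z"
    using pos_form_represent[OF assms(1) linear_frechet_derivative[OF assms(2)]] by blast
  then have "grad g F x = w" unfolding grad_def by (rule the_represent[OF assms(1)])
  with w show ?thesis by simp
qed

text \<open>The candidate is checked against the Koszul formula: differentiating
  \<open>exp (2 * F y)\<close> adds \<open>2 * dd F x c * g x a b\<close> to each of the three
  derivatives, and the division by 2 leaves exactly the three correction terms.\<close>

lemma christoffel_conf:
  assumes "metric_on U g" "x \<in> U" "\<And>x. x \<in> U \<Longrightarrow> F differentiable (at x)"
  shows "christoffel (conf F g) x u v =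
    christoffel g x u v + dd F x u *\<^sub>R v + dd F x v *\<^sub>R u - g x u v *\<^sub>R grad g F x"
proof (rule christoffel_eqI)
  have pos: "pos_form (g x)" using assms by (auto simp: metric_on_def)
  note bl = pos_formD(1)[OF pos]
  show "pos_form (conf F g x)"
    using metric_on_conf[OF assms(1,3)] assms(2) by (auto simp: metric_on_def)
  have d: "dd (\<lambda>y. conf F g y a b) x c = exp (2 * F x) * (2 * dd F x c * g x a b + dd (\<lambda>y. g y a b) x c)"
    for a b c
  proof -
    have "(\<lambda>y. g y a b) differentiable (at x)" using assms by (auto simp: metric_on_def)
    then have "((\<lambda>y. conf F g y a b) has_derivative
      (\<lambda>c. exp (2 * F x) * (2 * dd F x c * g x a b + dd (\<lambda>y. g y a b) x c))) (at x)"
      unfolding conf_def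
      by (auto intro!: derivative_eq_intros dd_works assms simp: algebra_simps)
    then show ?thesis by (simp add: dd_eqI)
  qed
  show "conf F g x (christoffel g x u v + dd F x u *\<^sub>R v + dd F x v *\<^sub>R u - g x u v *\<^sub>R grad g F x) z
    = koszul (conf F g) x u v z" for z
    unfolding koszul_def d
    by (simp add: conf_def bilinear_ladd[OF bl] bilinear_lmul[OF bl] bilinear_lsub[OF bl]
        grad_eq[where g = g and x = x and F = F, OF pos assms(3)[OF assms(2)]] christoffel_koszul[OF assms(1,2)] koszul_def field_simps)
qed

text \<open>Since \<open>dd F x = 0\<close>, the terms of the conformal change of curvature that are quadratic in
  the gradient vanish at \<open>x\<close>. The bilinear form \<open>\<lambda>w u. dd (\<lambda>y. dd F y u) x w\<close> is the
  Hessian of \<open>F\<close>; its symmetry is never used.\<close>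

context
  fixes U :: "'e::euclidean_space set" and g :: "'e form_field" and F :: "'e \<Rightarrow> real" and x :: 'e
    and hess :: "'e \<Rightarrow> 'e \<Rightarrow> real"
  assumes met: "metric_on U g" and xU: "x \<in> U"
    and dF: "\<And>y. y \<in> U \<Longrightarrow> F differentiable (at y)"
    and ddF: "\<And>u. (\<lambda>y. dd F y u) differentiable (at x)"
    and crit: "\<And>u. dd F x u = 0"
    and conn: "conn_at U (christoffel g) x"
    and hess_def: "\<And>w u. hess w u = dd (\<lambda>y. dd F y u) x w"
begin

lemma pos_form_at: "pos_form (g x)"
  and open_domain: "open U"
  using met xU by (auto simp: metric_on_def)

lemma grad_zero: "grad g F x = 0"
  by (rule pos_form_eqI[OF pos_form_at])
     (simp add: grad_eq[where g = g and x = x and F = F, OF pos_form_at dF[OF xU]] crit bilinear_lzero[OF pos_formD(1)[OF pos_form_at]])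

lemma grad_differentiable: "grad g F differentiable (at x)"
  by (rule differentiable_represent[where H = g and \<phi> = "dd F", OF open_domain xU])
     (use met xU dF grad_eq[where g = g and F = F] ddF in \<open>auto simp: metric_on_def\<close>)

text \<open>Differentiating \<open>g y (grad g F y) z = dd F y z\<close> gives one term with the
  derivative of the metric; it is multiplied by the gradient at \<open>x\<close> and so
  vanishes.\<close>

lemma grad_derivative: "g x (dd (grad g F) x w) z = hess w z"
proof -
  note bl = pos_formD(1)[OF pos_form_at]
  \<comment> \<open>Expanding the gradient in the standard basis reduces the moving form
    \<open>g y\<close> to products of real functions.\<close>
  have "((\<lambda>y. \<Sum>c\<in>Basis. (grad g F y \<bullet> c) * g y c z) has_derivative
      (\<lambda>w. \<Sum>c\<in>Basis. (grad g F x \<bullet> c) * dd (\<lambda>y. g y c z) x w + (dd (grad g F) x w \<bullet> c) * g x c z)) (at x)"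
    by (intro has_derivative_sum has_derivative_mult has_derivative_inner_left dd_works grad_differentiable)
       (use met xU in \<open>auto simp: metric_on_def\<close>)
  moreover have "(\<Sum>c\<in>Basis. (grad g F y \<bullet> c) * g y c z) = dd F y z" if "y \<in> U" for y
  proof -
    have pos: "pos_form (g y)" using met that by (auto simp: metric_on_def)
    have "g y (\<Sum>c\<in>Basis. (grad g F y \<bullet> c) *\<^sub>R c) z = (\<Sum>c\<in>Basis. (grad g F y \<bullet> c) * g y c z)"
      by (simp add: bilinear_sum_scaleR_left[OF pos_formD(1)[OF pos]])
    then show ?thesis
      by (simp add: euclidean_representation grad_eq[where g = g and x = y and F = F, OF pos dF[OF that]])
  qed
  ultimately have "((\<lambda>y. dd F y z) has_derivative
      (\<lambda>w. \<Sum>c\<in>Basis. (grad g F x \<bullet> c) * dd (\<lambda>y. g y c z) x w + (dd (grad g F) x w \<bullet> c) * g x c z)) (at x)"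
    by (rule has_derivative_transform_within_open[OF _ open_domain xU]) auto
  then have "hess w z = (\<Sum>c\<in>Basis. (dd (grad g F) x w \<bullet> c) * g x c z)"
    by (simp add: hess_def dd_eqI grad_zero)
  also have "\<dots> = g x (\<Sum>c\<in>Basis. (dd (grad g F) x w \<bullet> c) *\<^sub>R c) z"
    by (simp add: bilinear_sum_scaleR_left[OF bl])
  finally show ?thesis by (simp add: euclidean_representation)
qed

lemma christoffel_conf_has_derivative:
  "((\<lambda>y. christoffel (conf F g) y u v) has_derivative
    (\<lambda>w. dd (\<lambda>y. christoffel g y u v) x w + hess w u *\<^sub>R v + hess w v *\<^sub>R u
      - g x u v *\<^sub>R dd (grad g F) x w)) (at x)"
proof -
  have d1: "((\<lambda>y. christoffel g y u v) has_derivative dd (\<lambda>y. christoffel g y u v) x) (at x)"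
    by (rule dd_works) (use conn in \<open>simp add: conn_at_def\<close>)
  have d2: "((\<lambda>y. dd F y u) has_derivative (\<lambda>w. hess w u)) (at x)" for u
    unfolding hess_def by (rule dd_works[OF ddF])
  have d3: "((\<lambda>y. g y u v) has_derivative dd (\<lambda>y. g y u v) x) (at x)"
    by (rule dd_works) (use met xU in \<open>auto simp: metric_on_def\<close>)
  have "((\<lambda>y. christoffel g y u v + dd F y u *\<^sub>R v + dd F y v *\<^sub>R u - g y u v *\<^sub>R grad g F y) has_derivative
    (\<lambda>w. dd (\<lambda>y. christoffel g y u v) x w + hess w u *\<^sub>R v + hess w v *\<^sub>R u
      - (g x u v *\<^sub>R dd (grad g F) x w + dd (\<lambda>y. g y u v) x w *\<^sub>R grad g F x))) (at x)"
    by (intro has_derivative_add has_derivative_diff has_derivative_scaleR_left has_derivative_scaleR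
        d1 d2 d3 dd_works grad_differentiable)
  then show ?thesis
    unfolding grad_zero
    by (auto intro: has_derivative_transform_within_open[OF _ open_domain xU] simp: christoffel_conf[OF met _ dF])
qed

lemma conn_at_conf: "conn_at U (christoffel (conf F g)) x"
  using christoffel_conf_has_derivative bilinear_christoffel[OF metric_on_conf[OF met dF]] open_domain xU
  unfolding conn_at_def differentiable_def by blast

text \<open>The two sets of Christoffel symbols agree at \<open>x\<close>, hence so do the terms
  quadratic in them; only the derivatives of the symbols contribute a difference.\<close>

lemma curv_conf:
  "curv (christoffel (conf F g)) x u v w = curv (christoffel g) x u v w
    + hess u v *\<^sub>R w + hess u w *\<^sub>R v - g x v w *\<^sub>R dd (grad g F) x u
    - (hess v u *\<^sub>R w + hess v w *\<^sub>R u - g x u w *\<^sub>R dd (grad g F) x v)"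
proof -
  have eq: "christoffel (conf F g) x u v = christoffel g x u v" for u v
    by (simp add: christoffel_conf[OF met xU dF] crit grad_zero)
  show ?thesis
    unfolding curv_def eq dd_eqI[OF christoffel_conf_has_derivative] by (simp add: algebra_simps)
qed

lemma linear_hess: "linear (\<lambda>u. hess u v)"
  unfolding hess_def by (rule linear_frechet_derivative[OF ddF])

lemma linear_hess_right: "linear (hess u)"
  unfolding hess_def
  by (rule linear_dd_family[OF open_domain xU]) (use dF linear_frechet_derivative ddF in blast)+

text \<open>Tracing over \<open>u\<close> with both remaining arguments equal to \<open>v\<close>,
  the term \<open>hess v v *\<^sub>R u\<close> contributes \<open>- DIM('e)\<close> copies of
  \<open>hess v v\<close>, and the four rank-one terms contribute 2 copies net.\<close>

lemma Ric_conf: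
  "Ric (conf F g) x v v = Ric g x v v - (real DIM('e) - 2) * hess v v
    - g x v v * endo_trace (dd (grad g F) x)"
proof -
  have lin: "linear (\<lambda>u. g x u v)" using pos_formD(1)[OF pos_form_at] by (simp add: bilinear_def)
  show ?thesis
    unfolding Ric_def riemann_eq_curv curv_conf
    by (simp add: endo_trace_add endo_trace_diff endo_trace_scaleR endo_trace_id
        endo_trace_rank_one[OF linear_hess] endo_trace_rank_one[OF linear_hess_right]
        endo_trace_rank_one[OF lin] grad_derivative algebra_simps)
qed

lemma laplacian_onb:
  assumes "onb (g x) B"
  shows "endo_trace (dd (grad g F) x) = (\<Sum>e\<in>B. hess e e)"
  using endo_trace_onb[OF pos_form_at assms linear_frechet_derivative[OF grad_differentiable]]
  by (simp add: grad_derivative)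

lemma Scal_conf:
  assumes "onb (g x) B"
  shows "exp (2 * F x) * Scal (conf F g) x = (\<Sum>e\<in>B. Ric g x e e) - 2 * (real DIM('e) - 1) * (\<Sum>e\<in>B. hess e e)"
proof -
  have "exp (2 * F x) * Scal (conf F g) x = (\<Sum>e\<in>B. Ric (conf F g) x e e)"
    by (rule Scal_onb[OF pos_form_at assms]) (simp_all add: bilinear_Ric[OF conn_at_conf], simp add: conf_def)
  also have "\<dots> = (\<Sum>e\<in>B. Ric g x e e - (real DIM('e) - 2) * hess e e - endo_trace (dd (grad g F) x))"
    unfolding Ric_conf by (rule sum.cong) (simp_all add: onbD(2)[OF assms])
  also have "\<dots> = (\<Sum>e\<in>B. Ric g x e e) - (real DIM('e) - 2) * (\<Sum>e\<in>B. hess e e)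
      - DIM('e) * endo_trace (dd (grad g F) x)"
    by (simp add: sum_subtractf sum_distrib_left card_onb[OF pos_form_at assms])
  finally show ?thesis unfolding laplacian_onb[OF assms] by (simp add: algebra_simps)
qed

end

section \<open>Products\<close>

text \<open>\<open>product_metric\<close> in one pair of charts, written with projections instead of
  tuple patterns so that derivative rules apply.\<close>

definition prod_form :: "'e::euclidean_space form_field \<Rightarrow> 'f::euclidean_space form_field \<Rightarrow> ('e \<times> 'f) form_field" where
  "prod_form h0 h1 p u v = h0 (fst p) (fst u) (fst v) + h1 (snd p) (snd u) (snd v)"

lemma product_metric_eq: "product_metric g h (i, j) = prod_form (g i) (h j)"
  by (auto simp: fun_eq_iff product_metric_def prod_form_def)

lemma has_derivative_fst_arg:
  assumes "(f has_derivative f') (at (fst p))"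
  shows "((\<lambda>p. f (fst p)) has_derivative (\<lambda>w. f' (fst w))) (at p)"
  by (rule has_derivative_compose[OF has_derivative_fst[OF has_derivative_ident] assms])

lemma has_derivative_snd_arg:
  assumes "(f has_derivative f') (at (snd p))"
  shows "((\<lambda>p. f (snd p)) has_derivative (\<lambda>w. f' (snd w))) (at p)"
  by (rule has_derivative_compose[OF has_derivative_snd[OF has_derivative_ident] assms])

lemma pos_form_prod:
  assumes "pos_form b0" "pos_form b1"
  shows "pos_form (\<lambda>u v. b0 (fst u) (fst v) + b1 (snd u) (snd v))"
proof -
  note bl = pos_formD(1)[OF assms(1)] pos_formD(1)[OF assms(2)]
  have "b0 a a \<ge> 0" "b1 b b \<ge> 0" for a b
    using assms bilinear_lzero[OF bl(1)] bilinear_lzero[OF bl(2)]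
    unfolding pos_form_def by (metis order.refl less_imp_le)+
  then have "b0 a a + b1 b b > 0" if "(a, b) \<noteq> 0" for a b
    using that pos_formD(3)[OF assms(1), of a] pos_formD(3)[OF assms(2), of b]
    by (cases "a = 0") (auto simp: zero_prod_def intro: add_nonneg_pos add_pos_nonneg)
  moreover have "bilinear (\<lambda>u v. b0 (fst u) (fst v) + b1 (snd u) (snd v))"
    unfolding bilinear_def
    by (auto intro!: linearI simp: bilinear_ladd[OF bl(1)] bilinear_radd[OF bl(1)]
        bilinear_ladd[OF bl(2)] bilinear_radd[OF bl(2)] bilinear_lmul[OF bl(1)] bilinear_rmul[OF bl(1)]
        bilinear_lmul[OF bl(2)] bilinear_rmul[OF bl(2)] algebra_simps)
  ultimately show ?thesis
    using assms unfolding pos_form_def by auto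
qed

definition onb_prod :: "'e::euclidean_space set \<Rightarrow> 'f::euclidean_space set \<Rightarrow> ('e \<times> 'f) set" where
  "onb_prod B0 B1 = (\<lambda>e. (e, 0)) ` B0 \<union> (\<lambda>e. (0, e)) ` B1"

context
  fixes b0 :: "'e::euclidean_space \<Rightarrow> 'e \<Rightarrow> real" and b1 :: "'f::euclidean_space \<Rightarrow> 'f \<Rightarrow> real"
    and B0 B1
  assumes pos: "pos_form b0" "pos_form b1" and B: "onb b0 B0" "onb b1 B1"
begin

lemma sum_onb_prod: "(\<Sum>e\<in>onb_prod B0 B1. f e) = (\<Sum>e\<in>B0. f (e, 0)) + (\<Sum>e\<in>B1. f (0, e))"
proof -
  \<comment> \<open>The two embedded bases could meet only in \<open>(0, 0)\<close>.\<close>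
  have "0 \<notin> B0"
    using onbD(2)[OF B(1), of 0] bilinear_lzero[OF pos_formD(1)[OF pos(1)], of 0] by auto
  then have "(\<lambda>e. (e, 0)) ` B0 \<inter> (\<lambda>e. (0, e)) ` B1 = {}" by auto
  then show ?thesis
    unfolding onb_prod_def using onbD(1)[OF B(1)] onbD(1)[OF B(2)]
    by (simp add: sum.union_disjoint sum.reindex inj_on_def)
qed

lemma onb_onb_prod: "onb (\<lambda>u v. b0 (fst u) (fst v) + b1 (snd u) (snd v)) (onb_prod B0 B1)"
proof -
  note bl = pos_formD(1)[OF pos(1)] pos_formD(1)[OF pos(2)]
  have nz: "0 \<notin> B0" "0 \<notin> B1"
    using onbD(2)[OF B(1), of 0] bilinear_lzero[OF bl(1), of 0]
      onbD(2)[OF B(2), of 0] bilinear_lzero[OF bl(2), of 0] by auto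
  have o: "b0 e e' = (if e = e' then 1 else 0)" if "e \<in> B0" "e' \<in> B0" for e e'
    using B(1) that by (auto simp only: onb_def)
  have o': "b1 e e' = (if e = e' then 1 else 0)" if "e \<in> B1" "e' \<in> B1" for e e'
    using B(2) that by (auto simp only: onb_def)
  have expand: "(u, v) = (\<Sum>e\<in>onb_prod B0 B1. (b0 u (fst e) + b1 v (snd e)) *\<^sub>R e)" for u v
    using onbD(3)[OF B(1), of u] onbD(3)[OF B(2), of v] bilinear_rzero[OF bl(1)] bilinear_rzero[OF bl(2)]
    unfolding sum_onb_prod by (simp add: prod_eq_iff fst_sum snd_sum)
  show ?thesis
    unfolding onb_def
  proof (intro conjI ballI allI)
    show "finite (onb_prod B0 B1)"
      using onbD(1)[OF B(1)] onbD(1)[OF B(2)] by (simp add: onb_prod_def)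
    show "b0 (fst e) (fst e') + b1 (snd e) (snd e') = (if e = e' then 1 else 0)"
      if "e \<in> onb_prod B0 B1" "e' \<in> onb_prod B0 B1" for e e'
      using that nz by (auto simp: onb_prod_def o o' bilinear_rzero[OF bl(1)] bilinear_rzero[OF bl(2)]
          bilinear_lzero[OF bl(1)] bilinear_lzero[OF bl(2)] split: if_splits)
    show "w = (\<Sum>e\<in>onb_prod B0 B1. (b0 (fst w) (fst e) + b1 (snd w) (snd e)) *\<^sub>R e)" for w
      using expand[of "fst w" "snd w"] by simp
  qed
qed

end

lemma endo_trace_prod:
  "endo_trace L = endo_trace (\<lambda>u. fst (L (u, 0))) + endo_trace (\<lambda>u. snd (L (0, u)))"
proof -
  have *: "(\<lambda>u. (u, 0)) ` Basis \<inter> (\<lambda>u. (0, u)) ` Basis = {}" by auto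
  show ?thesis
    unfolding endo_trace_def Basis_prod_def
    by (subst sum.union_disjoint[OF _ _ *]) (simp_all add: sum.reindex inj_on_def inner_Pair_0)
qed

context
  fixes U0 :: "'e::euclidean_space set" and U1 :: "'f::euclidean_space set" and h0 h1
  assumes met: "metric_on U0 h0" "metric_on U1 h1"
begin

lemma prod_form_has_derivative:
  assumes "fst p \<in> U0" "snd p \<in> U1"
  shows "((\<lambda>p. prod_form h0 h1 p u v) has_derivative
    (\<lambda>w. dd (\<lambda>y. h0 y (fst u) (fst v)) (fst p) (fst w)
       + dd (\<lambda>y. h1 y (snd u) (snd v)) (snd p) (snd w))) (at p)"
  unfolding prod_form_def
  by (intro has_derivative_add has_derivative_fst_arg[where f = "\<lambda>y. h0 y _ _"]
      has_derivative_snd_arg[where f = "\<lambda>y. h1 y _ _"] dd_works)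
     (use assms met in \<open>auto simp: metric_on_def\<close>)

lemma metric_on_prod: "metric_on (U0 \<times> U1) (prod_form h0 h1)"
  unfolding metric_on_def
proof (intro conjI ballI allI)
  show "open (U0 \<times> U1)" using met by (auto simp: metric_on_def intro: open_Times)
  fix p assume "p \<in> U0 \<times> U1"
  then have p: "fst p \<in> U0" "snd p \<in> U1" by auto
  then show "pos_form (prod_form h0 h1 p)"
    using pos_form_prod[of "h0 (fst p)" "h1 (snd p)"] met
    by (auto simp: prod_form_def[abs_def] metric_on_def)
  show "(\<lambda>y. prod_form h0 h1 y u v) differentiable at p" for u v
    unfolding differentiable_def by (rule exI, rule prod_form_has_derivative[OF p])
qed

lemma christoffel_prod:
  assumes "p \<in> U0 \<times> U1"
  shows "christoffel (prod_form h0 h1) p u v =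
    (christoffel h0 (fst p) (fst u) (fst v), christoffel h1 (snd p) (snd u) (snd v))"
proof (rule christoffel_eqI)
  have p: "fst p \<in> U0" "snd p \<in> U1" using assms by auto
  show "pos_form (prod_form h0 h1 p)"
    using metric_on_prod assms by (auto simp: metric_on_def)
  show "prod_form h0 h1 p (christoffel h0 (fst p) (fst u) (fst v), christoffel h1 (snd p) (snd u) (snd v)) z
      = koszul (prod_form h0 h1) p u v z" for z
    unfolding koszul_def dd_eqI[OF prod_form_has_derivative[OF p]]
    by (simp add: prod_form_def christoffel_koszul[OF met(1) p(1)] christoffel_koszul[OF met(2) p(2)]
        koszul_def field_simps)
qed

context
  fixes x0 x1
  assumes conn: "conn_at U0 (christoffel h0) x0" "conn_at U1 (christoffel h1) x1"
begin

lemma christoffel_prod_has_derivative: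
  "((\<lambda>p. christoffel (prod_form h0 h1) p u v) has_derivative
    (\<lambda>w. (dd (\<lambda>y. christoffel h0 y (fst u) (fst v)) x0 (fst w),
          dd (\<lambda>y. christoffel h1 y (snd u) (snd v)) x1 (snd w)))) (at (x0, x1))"
proof -
  have "((\<lambda>p. (christoffel h0 (fst p) (fst u) (fst v), christoffel h1 (snd p) (snd u) (snd v)))
    has_derivative (\<lambda>w. (dd (\<lambda>y. christoffel h0 y (fst u) (fst v)) x0 (fst w),
          dd (\<lambda>y. christoffel h1 y (snd u) (snd v)) x1 (snd w)))) (at (x0, x1))"
    by (intro has_derivative_Pair has_derivative_fst_arg[where f = "\<lambda>y. christoffel h0 y _ _"]
      has_derivative_snd_arg[where f = "\<lambda>y. christoffel h1 y _ _"])
     (use conn in \<open>auto simp: conn_at_def intro: dd_works\<close>)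
  then show ?thesis
    by (rule has_derivative_transform_within_open[where s = "U0 \<times> U1"])
       (use conn in \<open>auto simp: conn_at_def christoffel_prod intro: open_Times\<close>)
qed

lemma conn_at_prod: "conn_at (U0 \<times> U1) (christoffel (prod_form h0 h1)) (x0, x1)"
  using christoffel_prod_has_derivative bilinear_christoffel[OF metric_on_prod] conn open_Times
  unfolding conn_at_def differentiable_def by blast

text \<open>The curvature acts on each factor separately, so its trace splits along the two
  coordinate subspaces.\<close>

lemma Ric_prod:
  "Ric (prod_form h0 h1) (x0, x1) v w = Ric h0 x0 (fst v) (fst w) + Ric h1 x1 (snd v) (snd w)"
proof -
  have x: "(x0, x1) \<in> U0 \<times> U1" using conn by (auto simp: conn_at_def)
  have "curv (christoffel (prod_form h0 h1)) (x0, x1) u v w =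
    (curv (christoffel h0) x0 (fst u) (fst v) (fst w), curv (christoffel h1) x1 (snd u) (snd v) (snd w))" for u
    unfolding curv_def dd_eqI[OF christoffel_prod_has_derivative] christoffel_prod[OF x] by simp
  then show ?thesis
    unfolding Ric_def riemann_eq_curv by (subst endo_trace_prod) simp
qed

end

end

section \<open>Space forms\<close>

text \<open>The sectional identity, cleared of its denominator, persists for dependent
  \<open>u\<close>, \<open>v\<close>, where both sides vanish. It can therefore be summed over any
  orthonormal basis, and Parseval subtracts 1 from the dimension.\<close>

lemma Ric_constant_sectional:
  fixes h :: "'e::euclidean_space form_field"
  assumes pos: "pos_form (h x)" and conn: "conn_at U (christoffel h) x" and "\<kappa> \<noteq> 0"
    and sec: "\<And>u v. u \<noteq> v \<Longrightarrow> independent {u, v} \<Longrightarrow> sectional h x u v = \<kappa>"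
  shows "Ric h x v v = \<kappa> * (real DIM('e) - 1) * h x v v"
proof -
  note bl = pos_formD(1)[OF pos]
  have R: "h x (riemann h x u v v) u = \<kappa> * (h x u u * h x v v - (h x u v)\<^sup>2)" for u
  proof (cases "u \<noteq> v \<and> independent {u, v}")
    case True
    then have "sectional h x u v = \<kappa>" using sec by blast
    \<comment> \<open>Division by zero yields 0, so a nonzero value of \<open>sectional\<close>
      forces its denominator to be nonzero.\<close>
    with \<open>\<kappa> \<noteq> 0\<close> show ?thesis
      by (auto simp: sectional_def field_simps)
  next
    case False
    have "v = 0 \<or> (\<exists>c. u = c *\<^sub>R v)"
    proof (cases "u = v")
      case True
      then have "u = 1 *\<^sub>R v" by simp
      then show ?thesis by blast
    next
      case False
      with \<open>\<not> (u \<noteq> v \<and> independent {u, v})\<close> show ?thesis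
        by (auto simp: independent_insert span_singleton split: if_splits)
    qed
    then show ?thesis
    proof
      assume "v = 0"
      then show ?thesis
        by (simp add: riemann_eq_curv linear_0[OF curv_linear(3)[OF conn]] bilinear_lzero[OF bl]
            bilinear_rzero[OF bl])
    next
      assume "\<exists>c. u = c *\<^sub>R v"
      then obtain c where c: "u = c *\<^sub>R v" by blast
      have "curv (christoffel h) x v v v = 0" by (simp add: curv_def)
      then have "riemann h x u v v = 0"
        unfolding riemann_eq_curv c by (simp add: linear_cmul[OF curv_linear(1)[OF conn]])
      then show ?thesis
        by (simp add: c bilinear_lzero[OF bl] bilinear_lmul[OF bl] bilinear_rmul[OF bl] power2_eq_square)
    qed
  qed
  obtain B where B: "onb (h x) B" using onb_exists[OF pos] by blast
  have "Ric h x v v = (\<Sum>e\<in>B. h x (riemann h x e v v) e)"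
    unfolding Ric_def
    by (rule endo_trace_onb[OF pos B]) (simp add: riemann_eq_curv curv_linear(1)[OF conn])
  also have "\<dots> = (\<Sum>e\<in>B. \<kappa> * (h x v v - h x v e * h x v e))"
    unfolding R
    by (rule sum.cong[OF refl]) (metis onbD(2)[OF B] power2_eq_square pos_formD(2)[OF pos] mult_1)
  also have "\<dots> = \<kappa> * (card B * h x v v - (\<Sum>e\<in>B. h x v e * h x v e))"
    by (simp add: sum_distrib_left[symmetric] sum_subtractf)
  finally show ?thesis
    by (simp add: onb_parseval[OF pos B] card_onb[OF pos B] algebra_simps)
qed

section \<open>The round sphere\<close>

text \<open>The length-scaling factor of inverse stereographic projection; at a sphere point
  \<open>(y, t)\<close> in chart \<open>s\<close> it equals \<open>1 - s * t\<close>.\<close>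

definition stereo_factor :: "'e::euclidean_space \<Rightarrow> real" where
  "stereo_factor x = 2 / (1 + x \<bullet> x)"

lemma stereo_factor_pos: "stereo_factor x > 0"
  unfolding stereo_factor_def by (intro divide_pos_pos add_pos_nonneg) auto

text \<open>Eliminates \<open>x \<bullet> x\<close> from the later computations, which then become
  polynomial in \<open>stereo_factor x\<close>.\<close>

lemma stereo_factor_eq: "stereo_factor x * (x \<bullet> x) = 2 - stereo_factor x"
proof -
  have "1 + x \<bullet> x > 0" by (intro add_pos_nonneg) auto
  then show ?thesis by (simp add: stereo_factor_def field_simps)
qed

lemma stereo_factor_has_derivative:
  "(stereo_factor has_derivative (\<lambda>u. - ((stereo_factor x)\<^sup>2 * (x \<bullet> u)))) (at x)"
proof -
  have *: "1 + x \<bullet> x \<noteq> 0" by (metis add_pos_nonneg inner_ge_zero less_irrefl zero_less_one)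
  show ?thesis
    unfolding stereo_factor_def
    by (rule derivative_eq_intros refl * | simp)+
       (simp add: fun_eq_iff inner_commute power2_eq_square field_simps *)
qed

definition stereo_inv :: "real \<Rightarrow> 'e::euclidean_space \<Rightarrow> 'e \<times> real" where
  "stereo_inv s x = (stereo_factor x *\<^sub>R x, s * (1 - stereo_factor x))"

context
  fixes s :: real
  assumes s: "s \<in> {1, -1}"
begin

lemma stereo_inv_in_dom: "stereo_inv s x \<in> chart_dom unit_sphere s"
proof -
  have "stereo_inv s x \<bullet> stereo_inv s x =
      stereo_factor x * (stereo_factor x * (x \<bullet> x)) + (1 - stereo_factor x) * (1 - stereo_factor x)"
    using s by (auto simp: stereo_inv_def)
  also have "\<dots> = 1" unfolding stereo_factor_eq by (simp add: algebra_simps)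
  finally have "stereo_inv s x \<bullet> stereo_inv s x = 1" .
  moreover have "stereo_inv s x \<noteq> (0, s)"
    using s stereo_factor_pos[of x] by (auto simp: stereo_inv_def)
  ultimately show ?thesis by (simp add: unit_sphere_def norm_eq_1)
qed

lemma chart_stereo_inv: "chart unit_sphere s (stereo_inv s x) = x"
  using s stereo_factor_pos[of x] by (auto simp: unit_sphere_def stereo_inv_def)

lemma stereo_inv_chart:
  assumes "p \<in> chart_dom unit_sphere s"
  shows "stereo_inv s (chart unit_sphere s p) = p"
proof -
  obtain y t where p: "p = (y, t)" by (cases p)
  have ss: "s * s = 1" using s by auto
  have n: "y \<bullet> y + t * t = 1" and ne: "(y, t) \<noteq> (0, s)"
    using assms by (auto simp: unit_sphere_def p norm_eq_1)
  have st: "1 - s * t \<noteq> 0"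
  proof
    assume "1 - s * t = 0"
    then have "t = s" using s by auto
    then show False using n ne ss by simp
  qed
  define x where "x = y /\<^sub>R (1 - s * t)"
  have "y \<bullet> y = (1 - s * t) * (1 + s * t)" using n s by (auto simp: algebra_simps)
  moreover have "x \<bullet> x = (y \<bullet> y) / ((1 - s * t) * (1 - s * t))"
    by (simp add: x_def divide_inverse)
  ultimately have "x \<bullet> x = (1 + s * t) / (1 - s * t)" using st by simp
  then have "1 + x \<bullet> x = 2 / (1 - s * t)" using st by (simp add: field_simps)
  then have "stereo_factor x = 1 - s * t" using st by (simp add: stereo_factor_def)
  then show ?thesis
    using st s by (auto simp: p unit_sphere_def stereo_inv_def x_def[symmetric])
       (auto simp: x_def)
qed

lemma chart_img_unit_sphere: "chart_img unit_sphere s = UNIV"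
  unfolding chart_img_def using stereo_inv_in_dom chart_stereo_inv by (metis image_eqI surj_def UNIV_eq_I)

lemma inj_chart_unit_sphere: "inj_on (chart unit_sphere s) (chart_dom unit_sphere s)"
  by (rule inj_on_inverseI) (rule stereo_inv_chart)

lemma chart_inv_unit_sphere: "chart_inv unit_sphere s = stereo_inv s"
  unfolding chart_inv_def
  by (rule ext) (rule inv_into_f_eq[OF inj_chart_unit_sphere stereo_inv_in_dom chart_stereo_inv])

lemma round_metric_eq: "round_metric s x u v = (stereo_factor x)\<^sup>2 * (u \<bullet> v)"
proof -
  let ?r = "stereo_factor x"
  have "(stereo_inv s has_derivative
    (\<lambda>u. (?r *\<^sub>R u + (- (?r\<^sup>2 * (x \<bullet> u))) *\<^sub>R x, s * (0 - - (?r\<^sup>2 * (x \<bullet> u)))))) (at x)"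
    unfolding stereo_inv_def
    by (intro has_derivative_Pair has_derivative_scaleR has_derivative_mult_right has_derivative_diff
       has_derivative_const has_derivative_ident stereo_factor_has_derivative)
  then have d: "dd (chart_inv unit_sphere s) x =
    (\<lambda>u. (?r *\<^sub>R u + (- (?r\<^sup>2 * (x \<bullet> u))) *\<^sub>R x, s * (0 - - (?r\<^sup>2 * (x \<bullet> u)))))"
    unfolding chart_inv_unit_sphere by (rule dd_eqI)
  \<comment> \<open>The deviation from conformality is collected into one multiple of
    \<open>(x \<bullet> u) * (x \<bullet> v)\<close>, whose last factor vanishes because
    \<open>s * s = 1\<close>.\<close>
  have "round_metric s x u v
      = ?r\<^sup>2 * (u \<bullet> v) + ?r^3 * (x \<bullet> u) * (x \<bullet> v) * (?r * (x \<bullet> x) + ?r * (s * s) - 2)"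
    unfolding round_metric_def d
    by (simp add: algebra_simps inner_commute power2_eq_square power3_eq_cube)
  moreover have "?r * (x \<bullet> x) + ?r * (s * s) - 2 = 0"
    using stereo_factor_eq[of x] s by auto
  ultimately show ?thesis by simp
qed

lemma round_metric_has_derivative:
  "((\<lambda>y. round_metric s y u v) has_derivative
    (\<lambda>w. - 2 * (stereo_factor x)^3 * (x \<bullet> w) * (u \<bullet> v))) (at x)"
  unfolding round_metric_eq
  by (rule derivative_eq_intros stereo_factor_has_derivative refl | simp)+
     (simp add: fun_eq_iff power2_eq_square power3_eq_cube)

lemma metric_on_round: "metric_on (UNIV :: 'e::euclidean_space set) (round_metric s)"
proof -
  have "pos_form (round_metric s x)" for x :: 'e
    using stereo_factor_pos[of x]
    unfolding pos_form_def bilinear_def round_metric_eq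
    by (auto intro!: linearI simp: algebra_simps inner_commute)
  then show ?thesis
    using round_metric_has_derivative unfolding metric_on_def differentiable_def by blast
qed

text \<open>This is the formula for a conformally flat metric, since the logarithm of
  \<open>stereo_factor\<close> has derivative \<open>- stereo_factor x * (x \<bullet> u)\<close> in
  direction \<open>u\<close>.\<close>

lemma christoffel_round:
  "christoffel (round_metric s) x u v =
    stereo_factor x *\<^sub>R ((u \<bullet> v) *\<^sub>R x - (x \<bullet> u) *\<^sub>R v - (x \<bullet> v) *\<^sub>R u)"
proof (rule christoffel_eqI)
  show "pos_form (round_metric s x)" using metric_on_round unfolding metric_on_def by blast
  show "round_metric s x (stereo_factor x *\<^sub>R ((u \<bullet> v) *\<^sub>R x - (x \<bullet> u) *\<^sub>R v - (x \<bullet> v) *\<^sub>R u)) z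
    = koszul (round_metric s) x u v z" for z
    unfolding koszul_def dd_eqI[OF round_metric_has_derivative]
    by (simp add: round_metric_eq inner_diff_left algebra_simps power2_eq_square power3_eq_cube inner_commute)
qed

lemma christoffel_round_has_derivative:
  "((\<lambda>y. christoffel (round_metric s) y u v) has_derivative
    (\<lambda>w. stereo_factor x *\<^sub>R ((u \<bullet> v) *\<^sub>R w - (w \<bullet> u) *\<^sub>R v - (w \<bullet> v) *\<^sub>R u)
      + (- ((stereo_factor x)\<^sup>2 * (x \<bullet> w))) *\<^sub>R ((u \<bullet> v) *\<^sub>R x - (x \<bullet> u) *\<^sub>R v - (x \<bullet> v) *\<^sub>R u))) (at x)"
  unfolding christoffel_round
  by (intro has_derivative_scaleR has_derivative_diff has_derivative_scaleR_right has_derivative_scaleR_left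
      has_derivative_inner_left has_derivative_ident stereo_factor_has_derivative)

lemma conn_at_round: "conn_at UNIV (christoffel (round_metric s)) x"
  using christoffel_round_has_derivative bilinear_christoffel[OF metric_on_round]
  unfolding conn_at_def differentiable_def by blast

lemma curv_round:
  "curv (christoffel (round_metric s)) x u v v = (stereo_factor x)\<^sup>2 *\<^sub>R ((v \<bullet> v) *\<^sub>R u - (u \<bullet> v) *\<^sub>R v)"
proof -
  define r where "r = stereo_factor x"
  have r2: "r * (x \<bullet> x) = 2 - r" unfolding r_def by (rule stereo_factor_eq)
  \<comment> \<open>Pairing both sides with an arbitrary vector leaves a polynomial identity between
    real numbers; \<open>r2\<close> then turns the coefficient into
    \<open>r\<^sup>2\<close>.\<close>
  have "curv (christoffel (round_metric s)) x u v v =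
    (2 * r - r * (r * (x \<bullet> x))) *\<^sub>R ((v \<bullet> v) *\<^sub>R u - (u \<bullet> v) *\<^sub>R v)"
    unfolding curv_def dd_eqI[OF christoffel_round_has_derivative]
    unfolding christoffel_round r_def[symmetric]
    by (rule vector_eq_rdot[THEN iffD1], rule allI)
       (simp add: inner_diff_right inner_diff_left inner_add_left algebra_simps inner_commute power2_eq_square)
  then show ?thesis unfolding r2 r_def[symmetric] by (simp add: algebra_simps power2_eq_square)
qed

lemma Ric_round:
  fixes x :: "'e::euclidean_space"
  shows "Ric (round_metric s) x v v = (real DIM('e) - 1) * round_metric s x v v"
proof -
  have l: "linear (\<lambda>u. u \<bullet> v)" by (simp add: linear_iff inner_add_left)
  show ?thesis
    unfolding Ric_def riemann_eq_curv curv_round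
    by (simp add: endo_trace_scaleR endo_trace_diff endo_trace_id endo_trace_rank_one[OF l])
       (simp add: round_metric_eq algebra_simps)
qed

end

section \<open>The Einstein tensor of the product at a minimum of the conformal factor\<close>

text \<open>If the second derivative along \<open>u\<close> were negative, the first derivative
  along the line would be negative just after \<open>x\<close>, and the mean value theorem would
  produce a value below the minimum.\<close>

lemma hessian_at_min:
  fixes F :: "'e::euclidean_space \<Rightarrow> real"
  assumes U: "open U" "x \<in> U" and dF: "\<And>y. y \<in> U \<Longrightarrow> F differentiable (at y)"
    and ddF: "(\<lambda>y. dd F y u) differentiable (at x)"
    and min: "\<And>y. y \<in> U \<Longrightarrow> F x \<le> F y"
  shows "dd F x u = 0" "dd (\<lambda>y. dd F y u) x u \<ge> 0"
proof -
  have "dd F x = (\<lambda>v. 0)"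
    using differential_zero_maxmin[OF U(2,1) dd_works[OF dF[OF U(2)]]] min by blast
  then show 0: "dd F x u = 0" by simp
  have line: "((\<lambda>t. x + t *\<^sub>R u) has_derivative (\<lambda>h. h *\<^sub>R u)) (at t)" for t :: real
    by (auto intro!: derivative_eq_intros)
  show "dd (\<lambda>y. dd F y u) x u \<ge> 0"
  proof (rule ccontr)
    assume neg: "\<not> dd (\<lambda>y. dd F y u) x u \<ge> 0"
    have "((\<lambda>t. dd F (x + t *\<^sub>R u) u) has_derivative (\<lambda>h. dd (\<lambda>y. dd F y u) x (h *\<^sub>R u))) (at 0)"
      by (rule has_derivative_compose[OF line]) (simp add: dd_works[OF ddF])
    then have "((\<lambda>t. dd F (x + t *\<^sub>R u) u) has_real_derivative dd (\<lambda>y. dd F y u) x u) (at 0)"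
      by (simp add: has_field_derivative_def linear_cmul[OF linear_frechet_derivative[OF ddF]]
          mult_commute_abs)
    from DERIV_neg_dec_right[OF this] neg obtain d where d: "d > 0"
      "\<And>h. 0 < h \<Longrightarrow> h < d \<Longrightarrow> dd F (x + h *\<^sub>R u) u < 0"
      using 0 by auto
    have "open ((\<lambda>t. x + t *\<^sub>R u) -` U)"
      using U by (intro continuous_open_vimage) (auto intro!: continuous_intros)
    moreover have "0 \<in> (\<lambda>t. x + t *\<^sub>R u) -` U" using U(2) by simp
    ultimately obtain e where "e > 0" and ball: "ball 0 e \<subseteq> (\<lambda>t. x + t *\<^sub>R u) -` U"
      by (rule openE)
    then have e: "e > 0" "\<And>t. \<bar>t\<bar> < e \<Longrightarrow> x + t *\<^sub>R u \<in> U" by auto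
    \<comment> \<open>Small enough for the derivative to be negative on the whole segment and for
      the segment to stay in \<open>U\<close>.\<close>
    define t where "t = min d e / 2"
    have t: "0 < t" "t < d" "t < e" using d e by (auto simp: t_def)
    have D: "((\<lambda>t. F (x + t *\<^sub>R u)) has_real_derivative dd F (x + z *\<^sub>R u) u) (at z)" if "0 \<le> z" "z \<le> t" for z
    proof -
      have zU: "x + z *\<^sub>R u \<in> U" using that t by (intro e) auto
      have "((\<lambda>t. F (x + t *\<^sub>R u)) has_derivative (\<lambda>h. dd F (x + z *\<^sub>R u) (h *\<^sub>R u))) (at z)"
        by (rule has_derivative_compose[OF line]) (rule dd_works[OF dF[OF zU]])
      then show ?thesis
        by (simp add: has_field_derivative_def linear_cmul[OF linear_frechet_derivative[OF dF[OF zU]]]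
            mult_commute_abs)
    qed
    obtain z where z: "0 < z" "z < t" "F (x + t *\<^sub>R u) - F (x + 0 *\<^sub>R u) = (t - 0) * dd F (x + z *\<^sub>R u) u"
      using MVT2[OF t(1) D] by blast
    have "dd F (x + z *\<^sub>R u) u < 0" using z t by (intro d) auto
    with t(1) have "t * dd F (x + z *\<^sub>R u) u < 0" by (rule mult_pos_neg)
    then have "F (x + t *\<^sub>R u) < F x" using z(3) by simp
    moreover have "F x \<le> F (x + t *\<^sub>R u)" using t by (intro min e) auto
    ultimately show False by simp
  qed
qed

context
  fixes s :: real and V :: "'b::euclidean_space set" and h1 :: "'b form_field"
    and x0 :: "'a::euclidean_space" and x1 :: 'b and g :: "('a \<times> 'b) form_field"
    and p q :: real
  assumes s: "s \<in> {1, -1}" and met: "metric_on V h1" and conn: "conn_at V (christoffel h1) x1"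
    and p_def: "p = DIM('a)" and q_def: "q = DIM('b)"
    and Ric1: "\<And>v. Ric h1 x1 v v = - ((q - 1) * h1 x1 v v)"
    and g_def: "g = prod_form (round_metric s) h1"
begin

lemma metric_on_round_prod: "metric_on (UNIV \<times> V) g"
  unfolding g_def by (rule metric_on_prod[OF metric_on_round[OF s] met])

lemma conn_at_round_prod: "conn_at (UNIV \<times> V) (christoffel g) (x0, x1)"
  unfolding g_def by (rule conn_at_prod[OF metric_on_round[OF s] met conn_at_round[OF s] conn])

lemma Ric_round_prod:
  "Ric g (x0, x1) v v = (p - 1) * round_metric s x0 (fst v) (fst v) - (q - 1) * h1 x1 (snd v) (snd v)"
  unfolding g_def Ric_prod[OF metric_on_round[OF s] met conn_at_round[OF s] conn] Ric_round[OF s] Ric1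
  by (simp add: p_def)

lemma pos_form_factors: "pos_form (round_metric s x0)" "pos_form (h1 x1)"
  using metric_on_round[OF s] met conn unfolding metric_on_def conn_at_def by blast+

lemma round_prod_at: "g (x0, x1) = (\<lambda>u v. round_metric s x0 (fst u) (fst v) + h1 x1 (snd u) (snd v))"
  by (simp add: fun_eq_iff g_def prod_form_def)

context
  fixes B0 B1
  assumes B: "onb (round_metric s x0) B0" "onb (h1 x1) B1"
begin

lemma onb_round_prod: "onb (g (x0, x1)) (onb_prod B0 B1)"
  unfolding round_prod_at by (rule onb_onb_prod[OF pos_form_factors B])

lemma sum_round_factor: "(\<Sum>e\<in>B0. c * round_metric s x0 e e) = p * c"
  using card_onb[OF pos_form_factors(1) B(1)] by (simp add: onbD(2)[OF B(1)] p_def)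

lemma sum_hyperbolic_factor: "(\<Sum>e\<in>B1. c * h1 x1 e e) = q * c"
  using card_onb[OF pos_form_factors(2) B(2)] by (simp add: onbD(2)[OF B(2)] q_def)

text \<open>The contributions \<open>p * (p - 1)\<close> and \<open>- q * (q - 1)\<close> of the
  factors, in factored form.\<close>

lemma sum_Ric_round_prod:
  "(\<Sum>e\<in>onb_prod B0 B1. Ric g (x0, x1) e e) = (p - q) * (p + q - 1)"
proof -
  have "(\<Sum>e\<in>onb_prod B0 B1. Ric g (x0, x1) e e)
      = (\<Sum>e\<in>B0. (p - 1) * round_metric s x0 e e) + (\<Sum>e\<in>B1. (1 - q) * h1 x1 e e)"
    unfolding sum_onb_prod[OF pos_form_factors B] Ric_round_prod
    using bilinear_lzero[OF pos_formD(1)[OF pos_form_factors(1)], of 0]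
      bilinear_lzero[OF pos_formD(1)[OF pos_form_factors(2)], of 0] by (simp add: algebra_simps)
  then show ?thesis
    unfolding sum_round_factor sum_hyperbolic_factor by (simp add: algebra_simps)
qed

end

lemma Scal_round_prod: "Scal g (x0, x1) = (p - q) * (p + q - 1)"
proof -
  obtain B0 B1 where B: "onb (round_metric s x0) B0" "onb (h1 x1) B1"
    using onb_exists[OF pos_form_factors(1)] onb_exists[OF pos_form_factors(2)] by blast
  have pos: "pos_form (g (x0, x1))"
    unfolding round_prod_at by (rule pos_form_prod[OF pos_form_factors])
  have "1 * Scal g (x0, x1) = (\<Sum>e\<in>onb_prod B0 B1. Ric g (x0, x1) e e)"
    by (rule Scal_onb[OF pos onb_round_prod[OF B]]) (simp_all add: bilinear_Ric[OF conn_at_round_prod])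
  then show ?thesis by (simp add: sum_Ric_round_prod[OF B])
qed

text \<open>The two inequalities say that the spherical and the hyperbolic eigenvalue of
  \<open>Ein_tensor k g\<close> are positive.\<close>

lemma Ein_tensor_round_prod_pos:
  assumes "k * (p - 1) < (p - q) * (p + q - 1)" "- k * (q - 1) < (p - q) * (p + q - 1)" "u \<noteq> 0"
  shows "Ein_tensor k g (x0, x1) u u > 0"
proof -
  let ?A = "round_metric s x0 (fst u) (fst u)" and ?B = "h1 x1 (snd u) (snd u)"
  have "Ein_tensor k g (x0, x1) u u =
      ((p - q) * (p + q - 1) - k * (p - 1)) * ?A + ((p - q) * (p + q - 1) + k * (q - 1)) * ?B"
    unfolding Ein_tensor_def Ric_round_prod Scal_round_prod round_prod_at by (simp add: algebra_simps)
  moreover have "?A \<ge> 0" "?B \<ge> 0"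
    using pos_form_factors bilinear_lzero[OF pos_formD(1)[OF pos_form_factors(1)], of 0]
      bilinear_lzero[OF pos_formD(1)[OF pos_form_factors(2)], of 0]
    unfolding pos_form_def by (metis order.refl less_imp_le)+
  moreover have "?A > 0 \<or> ?B > 0"
    using assms(3) pos_formD(3)[OF pos_form_factors(1), of "fst u"] pos_formD(3)[OF pos_form_factors(2), of "snd u"]
    by (auto simp: prod_eq_iff)
  moreover have "(p - q) * (p + q - 1) - k * (p - 1) > 0" "(p - q) * (p + q - 1) + k * (q - 1) > 0"
    using assms(1,2) by auto
  ultimately show ?thesis
    by (metis add_pos_nonneg add_nonneg_pos mult_pos_pos mult_nonneg_nonneg less_imp_le)
qed

lemma Ein_tensor_conf_at_min:
  assumes F: "\<And>y. y \<in> UNIV \<times> V \<Longrightarrow> F differentiable (at y)"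
      "\<And>u. (\<lambda>y. dd F y u) differentiable (at (x0, x1))"
    and min: "\<And>y. y \<in> UNIV \<times> V \<Longrightarrow> F (x0, x1) \<le> F y"
    and pq: "2 \<le> q" "q < p"
    and Scal: "Scal (conf F g) (x0, x1) > 0"
    and Ein: "\<And>u. u \<noteq> 0 \<Longrightarrow> Ein_tensor k (conf F g) (x0, x1) u u > 0"
  shows "k > 0 \<Longrightarrow> k * (p - 1) < (p - q) * (p + q - 1)"
    and "k < 0 \<Longrightarrow> - k * (q - 1) < (p - q) * (p + q - 1)"
proof -
  let ?x = "(x0, x1)"
  obtain B0 B1 where B: "onb (round_metric s x0) B0" "onb (h1 x1) B1"
    using onb_exists[OF pos_form_factors(1)] onb_exists[OF pos_form_factors(2)] by blast
  have xU: "?x \<in> UNIV \<times> V" and oU: "open (UNIV \<times> V)"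
    using conn by (auto simp: conn_at_def intro: open_Times)
  note nonneg = hessian_at_min[OF oU xU F(1) F(2) min]
  define hess where "hess w u = dd (\<lambda>y. dd F y u) ?x w" for w u
  note setting = metric_on_round_prod xU F nonneg(1) conn_at_round_prod hess_def
  define HS where "HS = (\<Sum>e\<in>B0. hess (e, 0) (e, 0))"
  define HM where "HM = (\<Sum>e\<in>B1. hess (0, e) (0, e))"
  have H: "HS \<ge> 0" "HM \<ge> 0"
    unfolding HS_def HM_def hess_def using nonneg(2) by (auto intro!: sum_nonneg)
  have tr: "(\<Sum>e\<in>onb_prod B0 B1. hess e e) = HS + HM"
    unfolding HS_def HM_def by (rule sum_onb_prod[OF pos_form_factors B])
  have dim: "real DIM('a \<times> 'b) = p + q" by (simp add: p_def q_def)
  \<comment> \<open>Since \<open>conf F g\<close> at the point is \<open>exp (2 * F ?x)\<close>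
    times \<open>g\<close>, this \<open>S\<close> is the coefficient of \<open>g\<close> in the
    Einstein tensor of the conformal metric.\<close>
  define S where "S = exp (2 * F ?x) * Scal (conf F g) ?x"
  have S_pos: "S > 0" using Scal by (simp add: S_def)
  have S: "S = (p - q) * (p + q - 1) - 2 * (p + q - 1) * (HS + HM)"
    unfolding S_def using Scal_conf[OF setting onb_round_prod[OF B]]
    by (simp only: tr dim sum_Ric_round_prod[OF B])
  have Ric: "Ric (conf F g) ?x v v = Ric g ?x v v - (p + q - 2) * hess v v - g ?x v v * (HS + HM)" for v
    using Ric_conf[OF setting] by (simp only: dim laplacian_onb[OF setting onb_round_prod[OF B]] tr)
  have Ein_eq: "Ein_tensor k (conf F g) ?x v v = S * g ?x v v - k * Ric (conf F g) ?x v v" for v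
    by (simp add: Ein_tensor_def S_def conf_def)
  have z: "round_metric s x0 0 0 = 0" "h1 x1 0 0 = 0"
    using bilinear_lzero[OF pos_formD(1)[OF pos_form_factors(1)]]
      bilinear_lzero[OF pos_formD(1)[OF pos_form_factors(2)]] by auto
  have "B0 \<noteq> {}" "B1 \<noteq> {}"
    using card_onb[OF pos_form_factors(1) B(1)] card_onb[OF pos_form_factors(2) B(2)] by auto
  have nz: "e \<noteq> 0" if "e \<in> B0" for e using onbD(2)[OF B(1) that] z by auto
  have nz': "e \<noteq> 0" if "e \<in> B1" for e using onbD(2)[OF B(2) that] z by auto
  \<comment> \<open>The \<open>g\<close>-trace over the spherical directions of the Ricci tensor of
    \<open>conf F g\<close>; the full Laplacian \<open>HS + HM\<close> enters once per
    direction.\<close>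
  define RS where "RS = p * (p - 1) - (p + q - 2) * HS - p * (HS + HM)"
  have "0 < (\<Sum>e\<in>B0. Ein_tensor k (conf F g) ?x (e, 0) (e, 0))"
    using onbD(1)[OF B(1)] \<open>B0 \<noteq> {}\<close> by (intro sum_pos Ein) (auto simp: zero_prod_def dest: nz)
  also have "\<dots> = (\<Sum>e\<in>B0. (S - k * (p - 1) + k * (HS + HM)) * round_metric s x0 e e
      + k * (p + q - 2) * hess (e, 0) (e, 0))"
    unfolding Ein_eq Ric Ric_round_prod round_prod_at by (simp add: z algebra_simps)
  also have "\<dots> = p * S - k * RS"
    unfolding sum.distrib sum_round_factor[OF B]
    unfolding sum_distrib_left[symmetric] HS_def[symmetric]
    by (simp add: RS_def algebra_simps)
  finally have sphere: "0 < p * S - k * RS" .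
  \<comment> \<open>The analogous trace over the hyperbolic directions.\<close>
  define RM where "RM = - (q * (q - 1)) - (p + q - 2) * HM - q * (HS + HM)"
  have "0 < (\<Sum>e\<in>B1. Ein_tensor k (conf F g) ?x (0, e) (0, e))"
    using onbD(1)[OF B(2)] \<open>B1 \<noteq> {}\<close> by (intro sum_pos Ein) (auto simp: zero_prod_def dest: nz')
  also have "\<dots> = (\<Sum>e\<in>B1. (S + k * (q - 1) + k * (HS + HM)) * h1 x1 e e
      + k * (p + q - 2) * hess (0, e) (0, e))"
    unfolding Ein_eq Ric Ric_round_prod round_prod_at by (simp add: z algebra_simps)
  also have "\<dots> = q * S - k * RM"
    unfolding sum.distrib sum_hyperbolic_factor[OF B]
    unfolding sum_distrib_left[symmetric] HM_def[symmetric]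
    by (simp add: RM_def algebra_simps)
  finally have hyp: "0 < q * S - k * RM" .
  show "k * (p - 1) < (p - q) * (p + q - 1)" if "k > 0"
  proof (rule ccontr)
    assume "\<not> k * (p - 1) < (p - q) * (p + q - 1)"
    \<comment> \<open>The value of \<open>k\<close> at which the spherical eigenvalue of
      \<open>Ein_tensor k g\<close> is zero.\<close>
    define k0 where "k0 = (p - q) * (p + q - 1) / (p - 1)"
    have k0: "k0 * (p - 1) = (p - q) * (p + q - 1)" using pq by (simp add: k0_def)
    have "k0 > 0" using pq by (simp add: k0_def)
    have "k0 \<le> k"
      using \<open>\<not> k * (p - 1) < _\<close> pq by (simp add: k0_def field_simps)
    \<comment> \<open>The trace \<open>p * S - k * RS\<close> is affine in \<open>k\<close> and
      positive both at 0 and at the given \<open>k\<close>, hence at \<open>k0\<close> in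
      between.\<close>
    have "k0 * RS < p * S"
    proof (cases "RS \<le> 0")
      case True
      then have "k0 * RS \<le> 0" using \<open>k0 > 0\<close> by (simp add: mult_nonneg_nonpos)
      also have "0 < p * S" using pq S_pos by simp
      finally show ?thesis .
    next
      case False
      then have "k0 * RS \<le> k * RS" using \<open>k0 \<le> k\<close> by (simp add: mult_right_mono)
      then show ?thesis using sphere by simp
    qed
    \<comment> \<open>Sorted by partial Laplacians: the constant term is zero by the choice of
      \<open>k0\<close>, and \<open>le1\<close> and \<open>le2\<close> make the other two
      coefficients nonpositive.\<close>
    moreover have "p * S - k0 * RS
      = HS * (k0 * (2 * p + q - 2) - 2 * p * (p + q - 1)) + HM * (p * (k0 - 2 * (p + q - 1)))
        + p * ((p - q) * (p + q - 1) - k0 * (p - 1))"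
      unfolding S RS_def by (simp add: algebra_simps)
    moreover have le1: "k0 * (2 * p + q - 2) \<le> 2 * p * (p + q - 1)"
    proof -
      have "(p - q) * (2 * p + q - 2) \<le> 2 * p * (p - 1)"
      proof -
        have "2 * p * (p - 1) - (p - q) * (2 * p + q - 2) = q * (p + q - 2)"
          by (simp add: algebra_simps)
        moreover have "q * (p + q - 2) \<ge> 0" using pq by (intro mult_nonneg_nonneg) auto
        ultimately show ?thesis by linarith
      qed
      then have "(p - q) * (2 * p + q - 2) * (p + q - 1) \<le> 2 * p * (p - 1) * (p + q - 1)"
        using pq by (intro mult_right_mono) auto
      then show ?thesis using pq by (simp add: k0_def field_simps)
    qed
    moreover have le2: "k0 \<le> 2 * (p + q - 1)"
    proof -
      have "(p - q) * (p + q - 1) \<le> (2 * (p - 1)) * (p + q - 1)"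
        using pq by (intro mult_right_mono) auto
      then show ?thesis using pq by (simp add: k0_def field_simps)
    qed
    moreover have "HS * (k0 * (2 * p + q - 2) - 2 * p * (p + q - 1)) \<le> 0"
      using H le1 by (intro mult_nonneg_nonpos) auto
    moreover have "HM * (p * (k0 - 2 * (p + q - 1))) \<le> 0"
      using H le2 pq by (intro mult_nonneg_nonpos) auto
    ultimately show False by (simp add: k0)
  qed
  show "- k * (q - 1) < (p - q) * (p + q - 1)" if "k < 0"
  proof (rule ccontr)
    assume "\<not> - k * (q - 1) < (p - q) * (p + q - 1)"
    \<comment> \<open>For negative \<open>k\<close> the Laplacian terms of both the Ricci part and
      the scalar part lower the trace, so the contradiction arises at the given \<open>k\<close>
      itself.\<close>
    then have "q * ((p - q) * (p + q - 1) + k * (q - 1)) \<le> 0"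
      using pq by (intro mult_nonneg_nonpos) auto
    moreover have "k * ((p + q - 2) * HM + q * (HS + HM)) \<le> 0"
      using that pq H by (intro mult_nonpos_nonneg add_nonneg_nonneg mult_nonneg_nonneg) auto
    moreover have "2 * q * (p + q - 1) * (HS + HM) \<ge> 0"
      using pq H by (intro mult_nonneg_nonneg) auto
    moreover have "q * S - k * RM = q * ((p - q) * (p + q - 1) + k * (q - 1))
      + k * ((p + q - 2) * HM + q * (HS + HM)) - 2 * q * (p + q - 1) * (HS + HM)"
      unfolding S RM_def by (simp add: algebra_simps)
    ultimately show False using hyp by simp
  qed
qed

end

section \<open>Charts and minima of smooth functions\<close>

lemma Ck_on_const: "Ck_on k S (\<lambda>x. c)"
  by (induction k arbitrary: c) auto

text \<open>The part of the manifold structure that makes chartwise continuity global. It passes to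
  products and can be verified directly for the stereographic charts.\<close>

definition topological_atlas :: "('p, 'i, 'e::euclidean_space) mfd \<Rightarrow> bool" where
  "topological_atlas M \<longleftrightarrow>
     (\<Union>i\<in>charts M. chart_dom M i) = topspace (points M) \<and>
     (\<forall>i\<in>charts M. openin (points M) (chart_dom M i) \<and> inj_on (chart M i) (chart_dom M i) \<and>
        continuous_map (subtopology (points M) (chart_dom M i)) (top_of_set (chart_img M i)) (chart M i))"

lemma topological_atlasD:
  assumes "topological_atlas M" "i \<in> charts M"
  shows "openin (points M) (chart_dom M i)" "inj_on (chart M i) (chart_dom M i)"
    "continuous_map (subtopology (points M) (chart_dom M i)) (top_of_set (chart_img M i)) (chart M i)"
    "chart_dom M i \<subseteq> topspace (points M)"
  using assms unfolding topological_atlas_def by blast+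

lemma topological_atlas_smooth_manifold:
  assumes "smooth_manifold M"
  shows "topological_atlas M"
proof -
  have "inj_on (chart M i) (chart_dom M i)"
    "continuous_map (subtopology (points M) (chart_dom M i)) (top_of_set (chart_img M i)) (chart M i)"
    if "i \<in> charts M" for i
  proof -
    have hom: "homeomorphic_map (subtopology (points M) (chart_dom M i)) (top_of_set (chart_img M i)) (chart M i)"
      and sub: "chart_dom M i \<subseteq> topspace (points M)"
      using assms that by (auto simp: smooth_manifold_def)
    show "inj_on (chart M i) (chart_dom M i)"
      using homeomorphic_imp_injective_map[OF hom] sub by (simp add: inf.absorb2)
    show "continuous_map (subtopology (points M) (chart_dom M i)) (top_of_set (chart_img M i)) (chart M i)"
      by (rule homeomorphic_imp_continuous_map[OF hom])
  qed
  then show ?thesis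
    using assms unfolding topological_atlas_def smooth_manifold_def by blast
qed

lemma topological_atlas_unit_sphere:
  "topological_atlas (unit_sphere :: ('e::euclidean_space \<times> real, real, 'e) mfd)"
  unfolding topological_atlas_def
proof (intro conjI ballI)
  show "(\<Union>s\<in>charts unit_sphere. chart_dom unit_sphere s) = topspace (points (unit_sphere :: ('e \<times> real, real, 'e) mfd))"
    by (auto simp: unit_sphere_def)
  fix s :: real assume "s \<in> charts (unit_sphere :: ('e \<times> real, real, 'e) mfd)"
  then have s: "s \<in> {1, -1}" by (simp add: unit_sphere_def)
  show "openin (points unit_sphere) (chart_dom (unit_sphere :: ('e \<times> real, real, 'e) mfd) s)"
    by (simp add: unit_sphere_def openin_delete)
  show "inj_on (chart unit_sphere s) (chart_dom (unit_sphere :: ('e \<times> real, real, 'e) mfd) s)"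
    by (rule inj_chart_unit_sphere[OF s])
  have "1 - s * t \<noteq> 0" if "(y, t) \<in> chart_dom unit_sphere s" for y :: 'e and t
  proof
    assume "1 - s * t = 0"
    then have "t = s" using s by auto
    then show False using that s by (auto simp: unit_sphere_def norm_eq_1)
  qed
  then have "continuous_on (chart_dom unit_sphere s) (\<lambda>p :: 'e \<times> real. fst p /\<^sub>R (1 - s * snd p))"
    by (intro continuous_intros) auto
  moreover have "chart unit_sphere s = (\<lambda>p :: 'e \<times> real. fst p /\<^sub>R (1 - s * snd p))"
    by (auto simp: unit_sphere_def fun_eq_iff)
  moreover have "subtopology (points unit_sphere) (chart_dom unit_sphere s)
      = top_of_set (chart_dom (unit_sphere :: ('e \<times> real, real, 'e) mfd) s)"
    by (simp add: unit_sphere_def subtopology_subtopology Int_absorb1)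
  ultimately show "continuous_map (subtopology (points unit_sphere) (chart_dom unit_sphere s))
      (top_of_set (chart_img (unit_sphere :: ('e \<times> real, real, 'e) mfd) s)) (chart unit_sphere s)"
    by (simp add: chart_img_unit_sphere[OF s])
qed

lemma chart_img_product: "chart_img (product_mfd M N) (i, j) = chart_img M i \<times> chart_img N j"
  by (simp add: chart_img_def product_mfd_def map_prod_surj_on[OF refl refl])

lemma topological_atlas_product:
  assumes M: "topological_atlas M" and N: "topological_atlas N"
  shows "topological_atlas (product_mfd M N)"
  unfolding topological_atlas_def
proof (intro conjI ballI)
  show "(\<Union>i\<in>charts (product_mfd M N). chart_dom (product_mfd M N) i) = topspace (points (product_mfd M N))"
  proof -
    have "(\<Union>i\<in>charts (product_mfd M N). chart_dom (product_mfd M N) i)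
      = (\<Union>i\<in>charts M. chart_dom M i) \<times> (\<Union>j\<in>charts N. chart_dom N j)"
      by (auto simp: product_mfd_def)
    then show ?thesis using M N by (simp add: topological_atlas_def product_mfd_def)
  qed
  fix k assume "k \<in> charts (product_mfd M N)"
  then obtain i j where k: "k = (i, j)" and i: "i \<in> charts M" and j: "j \<in> charts N"
    by (auto simp: product_mfd_def)
  note Mi = topological_atlasD[OF M i] and Nj = topological_atlasD[OF N j]
  show "openin (points (product_mfd M N)) (chart_dom (product_mfd M N) k)"
    using Mi(1) Nj(1) by (simp add: k product_mfd_def openin_prod_Times_iff)
  show "inj_on (chart (product_mfd M N) k) (chart_dom (product_mfd M N) k)"
    using map_prod_inj_on[OF Mi(2) Nj(2)] by (simp add: k product_mfd_def)
  show "continuous_map (subtopology (points (product_mfd M N)) (chart_dom (product_mfd M N) k))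
      (top_of_set (chart_img (product_mfd M N) k)) (chart (product_mfd M N) k)"
    unfolding k chart_img_product
    using Mi(3) Nj(3)
    by (simp add: product_mfd_def subtopology_Times continuous_map_prod_top
        map_prod_def flip: prod_topology_subtopology_eu)
qed

text \<open>The chart expressions paste to a continuous function on a compact space; its global
  minimum is a minimum over any chart domain containing the point.\<close>

lemma minimum_in_chart:
  fixes f :: "'p \<Rightarrow> real" and M :: "('p, 'i, 'e::euclidean_space) mfd"
  assumes M: "topological_atlas M" and comp: "compact_space (points M)" "topspace (points M) \<noteq> {}"
    and cont: "\<And>i. i \<in> charts M \<Longrightarrow> continuous_on (chart_img M i) (f \<circ> chart_inv M i)"
  obtains i x where "i \<in> charts M" "x \<in> chart_img M i"
    "\<And>y. y \<in> chart_img M i \<Longrightarrow> (f \<circ> chart_inv M i) x \<le> (f \<circ> chart_inv M i) y"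
proof -
  have inv: "chart_inv M i (chart M i P) = P" if "i \<in> charts M" "P \<in> chart_dom M i" for i P
    unfolding chart_inv_def using that by (intro inv_into_f_f topological_atlasD[OF M])
  have "continuous_map (points M) euclideanreal f"
  proof (rule pasting_lemma[where I = "charts M" and T = "chart_dom M" and f = "\<lambda>i. f"])
    fix i assume i: "i \<in> charts M"
    show "openin (points M) (chart_dom M i)" by (rule topological_atlasD[OF M i])
    have "continuous_map (top_of_set (chart_img M i)) euclideanreal (f \<circ> chart_inv M i)"
      using cont[OF i] by simp
    with topological_atlasD(3)[OF M i]
    have "continuous_map (subtopology (points M) (chart_dom M i)) euclideanreal ((f \<circ> chart_inv M i) \<circ> chart M i)"
      by (rule continuous_map_compose)
    then show "continuous_map (subtopology (points M) (chart_dom M i)) euclideanreal f"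
      by (rule continuous_map_eq) (auto simp: inv[OF i])
  next
    fix P assume "P \<in> topspace (points M)"
    then show "\<exists>j. j \<in> charts M \<and> P \<in> chart_dom M j \<and> f P = f P"
      using M by (auto simp: topological_atlas_def)
  qed simp
  then have "compact (f ` topspace (points M))"
    using image_compactin comp(1) unfolding compact_space_def by fastforce
  then obtain P where P: "P \<in> topspace (points M)" and min: "\<And>Q. Q \<in> topspace (points M) \<Longrightarrow> f P \<le> f Q"
    using compact_attains_inf[of "f ` topspace (points M)"] comp(2) by auto
  obtain i where i: "i \<in> charts M" "P \<in> chart_dom M i"
    using P M by (auto simp: topological_atlas_def)
  show ?thesis
  proof (rule that[OF i(1)])
    show "chart M i P \<in> chart_img M i" using i by (simp add: chart_img_def)
    fix y assume "y \<in> chart_img M i"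
    then have "chart_inv M i y \<in> chart_dom M i"
      unfolding chart_img_def chart_inv_def by (rule inv_into_into)
    then show "(f \<circ> chart_inv M i) (chart M i P) \<le> (f \<circ> chart_inv M i) y"
      using min topological_atlasD(4)[OF M i(1)] by (auto simp: inv[OF i])
  qed
qed

lemma compact_space_unit_sphere: "compact_space (points unit_sphere)"
  by (simp add: unit_sphere_def compact_space_subtopology)

lemma topspace_unit_sphere_nonempty: "topspace (points unit_sphere) \<noteq> {}"
proof -
  have "(0, 1) \<in> sphere (0 :: 'a \<times> real) 1" by (simp add: norm_Pair)
  then show ?thesis unfolding unit_sphere_def by auto
qed

section \<open>Regularity of a smooth metric in a chart\<close>

lemma smooth_on_twice_differentiable:
  fixes f :: "'e::euclidean_space \<Rightarrow> 'b::euclidean_space"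
  assumes "smooth_on S f" "x \<in> S"
  shows "f differentiable (at x)" "(\<lambda>y. dd f y u) differentiable (at x)"
proof -
  have "Ck_on (Suc (Suc 0)) S f" using assms(1) by (auto simp: smooth_on_def simp del: Ck_on.simps)
  then show "f differentiable (at x)" "(\<lambda>y. dd f y u) differentiable (at x)"
    using assms(2) by auto
qed

lemma metric_on_chart:
  assumes "smooth_manifold M" "riemannian_metric M g" "i \<in> charts M"
  shows "metric_on (chart_img M i) (g i)"
    and "x \<in> chart_img M i \<Longrightarrow> conn_at (chart_img M i) (christoffel (g i)) x"
proof -
  have sm: "smooth_on (chart_img M i) (\<lambda>x. g i x u v)" for u v
    using assms by (auto simp: riemannian_metric_def)
  show met: "metric_on (chart_img M i) (g i)"
    using assms smooth_on_twice_differentiable(1)[OF sm]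
    unfolding metric_on_def pos_form_def riemannian_metric_def smooth_manifold_def by blast
  show "conn_at (chart_img M i) (christoffel (g i)) x" if "x \<in> chart_img M i"
    by (rule conn_at_christoffel[OF met that smooth_on_twice_differentiable(2)[OF sm that]])
qed

section \<open>Values of both invariants for the product metric and over its conformal class\<close>

theorem corollaryA:
  fixes n d :: nat
    and S :: "('a::euclidean_space \<times> real, real, 'a) mfd"
    and M :: "('p, 'i, 'b::euclidean_space) mfd"
    and N :: "(('a \<times> real) \<times> 'p, real \<times> 'i, 'a \<times> 'b) mfd"
    and g0 :: "real \<Rightarrow> 'a form_field"
    and g1 :: "'i \<Rightarrow> 'b form_field"
    and g :: "real \<times> 'i \<Rightarrow> ('a \<times> 'b) form_field"
  assumes "n > 0" and "d > 0" and "real d < (real n - 2) / 2"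
    and "DIM('a) = n - d - 1" and "DIM('b) = d + 1"
    and "S = unit_sphere" and "g0 = round_metric"
    and "compact_connected_space_form (- 1) M g1"
    and "N = product_mfd S M" and "g = product_metric g0 g1"
  shows "Ein_conf N g = Ein N g \<and>
         Ein N g = ereal ((real n - 1) * ((2 * real d - real n + 2) / (real d - real n + 2))) \<and>
         ein_conf N g = ein N g \<and>
         ein N g = ereal (- ((real n - 1) * ((real n - 2 * real d - 2) / real d))) \<and>
         g \<in> conformal_class N g"
proof -
  define p where "p = real DIM('a)"
  define q where "q = real DIM('b)"
  \<comment> \<open>The bound on \<open>d\<close> keeps the natural subtraction in
    \<open>DIM('a)\<close> from truncating.\<close>
  have p: "p = real n - real d - 1" using assms(3,4) by (simp add: p_def)
  have q: "q = real d + 1" using assms(5) by (simp add: q_def)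
  \<comment> \<open>Here \<open>d > 0\<close> becomes \<open>2 \<le> q\<close>, and the bound on
    \<open>d\<close> becomes \<open>q < p\<close>.\<close>
  have pq: "2 \<le> q" "q < p" using assms(2,3) by (auto simp: p q field_simps)
  define k0 where "k0 = (p - q) * (p + q - 1) / (p - 1)"
  define k1 where "k1 = - ((p - q) * (p + q - 1) / (q - 1))"
  \<comment> \<open>Here \<open>p + q = n\<close>, \<open>p - q = n - 2 * d - 2\<close> and
    \<open>p - 1 = n - d - 2\<close>; the stated quotient has both signs reversed.\<close>
  have k0: "k0 = (real n - 1) * ((2 * real d - real n + 2) / (real d - real n + 2))"
    using assms(3) by (simp add: k0_def p q field_simps)
  have k1: "k1 = - ((real n - 1) * ((real n - 2 * real d - 2) / real d))"
    by (simp add: k1_def p q algebra_simps)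
  have k0_iff: "k < k0 \<longleftrightarrow> k * (p - 1) < (p - q) * (p + q - 1)" for k
    using pq by (simp add: k0_def field_simps)
  have k1_iff: "k1 < k \<longleftrightarrow> - k * (q - 1) < (p - q) * (p + q - 1)" for k
    using pq by (simp add: k1_def field_simps)
  have "k0 > 0" "k1 < 0" using pq by (simp_all add: k0_def k1_def)
  \<comment> \<open>The supremum defining \<open>Ein\<close> ranges only over \<open>k\<close> below
    the dimension; this bound keeps the interval below \<open>k0\<close> inside that range.\<close>
  have "k0 < real DIM('a \<times> 'b)"
  proof -
    have "(p + q) * (p - 1) - (p - q) * (p + q - 1) = q * (p + q - 2)" by (simp add: algebra_simps)
    moreover have "q * (p + q - 2) > 0" using pq by (intro mult_pos_pos) auto
    ultimately have "(p - q) * (p + q - 1) < (p + q) * (p - 1)" by linarith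
    then show ?thesis using pq by (simp add: k0_def p_def[symmetric] q_def[symmetric] field_simps)
  qed
  have M: "smooth_manifold M" "riemannian_metric M g1" "compact_space (points M)" "topspace (points M) \<noteq> {}"
    and sec: "\<And>j x u v. j \<in> charts M \<Longrightarrow> x \<in> chart_img M j \<Longrightarrow> u \<noteq> v \<Longrightarrow> independent {u, v}
        \<Longrightarrow> sectional (g1 j) x u v = - 1"
    using assms(8) by (auto simp: compact_connected_space_form_def)
  have N: "topological_atlas N"
    unfolding assms(6,9)
    by (intro topological_atlas_product topological_atlas_unit_sphere topological_atlas_smooth_manifold M)
  have N_comp: "compact_space (points N)" "topspace (points N) \<noteq> {}"
    using M(3,4) compact_space_unit_sphere topspace_unit_sphere_nonempty
    by (auto simp: assms(6,9) product_mfd_def compact_space_prod_topology)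
  have chart_N: "s \<in> {1, -1}" "j \<in> charts M"
      "chart_img N (s, j) = UNIV \<times> chart_img M j" "g (s, j) = prod_form (round_metric s) (g1 j)"
    if "(s, j) \<in> charts N" for s j
  proof -
    show s: "s \<in> {1, -1}" "j \<in> charts M" using that by (auto simp: assms(6,9) product_mfd_def unit_sphere_def)
    show "chart_img N (s, j) = UNIV \<times> chart_img M j"
      by (simp add: assms(6,9) chart_img_product chart_img_unit_sphere[OF s(1)])
    show "g (s, j) = prod_form (round_metric s) (g1 j)"
      by (simp add: assms(7,10) product_metric_eq)
  qed
  have Ric1: "Ric (g1 j) x v v = - ((q - 1) * g1 j x v v)" if "j \<in> charts M" "x \<in> chart_img M j" for j x v
  proof -
    have "pos_form (g1 j x)" using metric_on_chart(1)[OF M(1,2) that(1)] that(2) by (auto simp: metric_on_def)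
    from Ric_constant_sectional[where h = "g1 j" and x = x, OF this metric_on_chart(2)[OF M(1,2) that] _ sec[OF that]]
    show ?thesis by (simp add: q_def algebra_simps)
  qed
  note local_setting = chart_N(1) metric_on_chart[OF M(1,2) chart_N(2)] Ric1[OF chart_N(2)]

  have bounds: "Ein N h \<le> ereal k0 \<and> ereal k1 \<le> ein N h" if h_mem: "h \<in> conformal_class N g" for h
  proof -
    obtain f where f: "smooth_function N f" and h: "h = (\<lambda>i. conf (f \<circ> chart_inv N i) (g i))"
      using h_mem unfolding conformal_class_def conf_def comp_def by blast
    have sm: "smooth_on (chart_img N i) (f \<circ> chart_inv N i)" if "i \<in> charts N" for i
      using f that by (auto simp: smooth_function_def)
    have "continuous_on (chart_img N i) (f \<circ> chart_inv N i)" if "i \<in> charts N" for i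
      using smooth_on_twice_differentiable(1)[OF sm[OF that]]
      by (meson continuous_at_imp_continuous_on differentiable_imp_continuous_within)
    then obtain i x where i: "i \<in> charts N" "x \<in> chart_img N i"
      and min: "\<And>y. y \<in> chart_img N i \<Longrightarrow> (f \<circ> chart_inv N i) x \<le> (f \<circ> chart_inv N i) y"
      using minimum_in_chart[OF N N_comp] by blast
    obtain s j where sj: "i = (s, j)" by (cases i)
    obtain x0 x1 where x: "x = (x0, x1)" by (cases x)
    have ch: "(s, j) \<in> charts N" and x1: "x1 \<in> chart_img M j"
      using i chart_N(3)[of s j] by (auto simp: sj x)
    define F where "F = f \<circ> chart_inv N i"
    have F: "F differentiable (at y)" if "y \<in> UNIV \<times> chart_img M j" for y
      using smooth_on_twice_differentiable(1)[OF sm[OF i(1)]] that chart_N(3)[OF ch] by (simp add: F_def sj)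
    have ddF: "(\<lambda>y. dd F y u) differentiable (at (x0, x1))" for u
      using smooth_on_twice_differentiable(2)[OF sm[OF i(1)] i(2)] by (simp add: F_def x)
    have Fmin: "F (x0, x1) \<le> F y" if "y \<in> UNIV \<times> chart_img M j" for y
      using min that chart_N(3)[OF ch] by (simp add: F_def sj x)
    have hi: "h i = conf F (g (s, j))" by (simp add: h F_def sj)
    have *: "(k > 0 \<longrightarrow> k < k0) \<and> (k < 0 \<longrightarrow> k1 < k)" if "Scal_pos N h" "Ein_pos N h k" for k
    proof -
      have "Scal (conf F (g (s, j))) (x0, x1) > 0"
        using that(1) i by (auto simp: Scal_pos_def hi[symmetric] x)
      moreover have "Ein_tensor k (conf F (g (s, j))) (x0, x1) u u > 0" if "u \<noteq> 0" for u
        using \<open>Ein_pos N h k\<close> i that unfolding Ein_pos_def hi[symmetric] x by blast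
      ultimately show ?thesis
        using Ein_tensor_conf_at_min[OF local_setting(1)[OF ch] local_setting(2)[OF ch]
            local_setting(3)[OF ch x1] p_def q_def local_setting(4)[OF ch x1] chart_N(4)[OF ch]
            F ddF Fmin pq]
        by (simp add: k0_iff k1_iff)
    qed
    show ?thesis
    proof (cases "Scal_pos N h")
      case True
      then show ?thesis
        using * by (auto simp: Ein_def ein_def less_imp_le intro!: SUP_least INF_greatest)
    next
      \<comment> \<open>Without positive scalar curvature both invariants default to 0, which lies
        between \<open>k1\<close> and \<open>k0\<close>.\<close>
      case False
      then show ?thesis
        using \<open>k0 > 0\<close> \<open>k1 < 0\<close> by (simp add: Ein_def ein_def)
    qed
  qed
  have self: "g \<in> conformal_class N g"
  proof -
    have "smooth_function N (\<lambda>_. 0)"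
      by (simp add: smooth_function_def smooth_on_def comp_def Ck_on_const)
    then show ?thesis
      unfolding conformal_class_def by (auto intro!: exI[of _ "\<lambda>_. 0"])
  qed
  have Scal_pos_g: "Scal_pos N g"
    unfolding Scal_pos_def
  proof (intro ballI)
    fix i x assume i: "i \<in> charts N" "x \<in> chart_img N i"
    obtain s j where sj: "i = (s, j)" by (cases i)
    obtain x0 x1 where x: "x = (x0, x1)" by (cases x)
    have ch: "(s, j) \<in> charts N" and x1: "x1 \<in> chart_img M j"
      using i chart_N(3)[of s j] by (auto simp: sj x)
    show "Scal (g i) x > 0"
      unfolding sj x Scal_round_prod[OF local_setting(1)[OF ch] local_setting(2)[OF ch]
            local_setting(3)[OF ch x1] p_def q_def local_setting(4)[OF ch x1] chart_N(4)[OF ch]]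
      using pq by simp
  qed
  have Ein_pos_g: "Ein_pos N g k" if "k1 < k" "k < k0" for k
    unfolding Ein_pos_def
  proof (intro ballI allI impI)
    fix i x and u :: "'a \<times> 'b" assume i: "i \<in> charts N" "x \<in> chart_img N i" and u: "u \<noteq> 0"
    obtain s j where sj: "i = (s, j)" by (cases i)
    obtain x0 x1 where x: "x = (x0, x1)" by (cases x)
    have ch: "(s, j) \<in> charts N" and x1: "x1 \<in> chart_img M j"
      using i chart_N(3)[of s j] by (auto simp: sj x)
    show "Ein_tensor k (g i) x u u > 0"
      unfolding sj x
      by (rule Ein_tensor_round_prod_pos[OF local_setting(1)[OF ch] local_setting(2)[OF ch]
            local_setting(3)[OF ch x1] p_def q_def local_setting(4)[OF ch x1] chart_N(4)[OF ch]])
        (use that u k0_iff k1_iff in auto)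
  qed
  have "ereal k0 \<le> Ein N g"
  \<comment> \<open>At \<open>k0\<close> itself the tensor degenerates on the sphere, so the value
    is approached from below; 0 bounds the range because \<open>Ein\<close> admits only positive
    \<open>k\<close>.\<close>
  proof (rule dense_le_bounded[of 0])
    fix w assume w: "0 < w" "w < ereal k0"
    then obtain k where k: "w = ereal k" "0 < k" "k < k0" by (cases w) auto
    then show "w \<le> Ein N g"
      using Scal_pos_g Ein_pos_g[of k] \<open>k1 < 0\<close> \<open>k0 < real DIM('a \<times> 'b)\<close>
      by (auto simp: Ein_def intro!: SUP_upper)
  qed (use \<open>k0 > 0\<close> in simp)
  then have Ein: "Ein N g = ereal k0" using bounds[OF self] by auto
  have "ein N g \<le> ereal k1"
  \<comment> \<open>Likewise \<open>k1\<close> is approached from above through negative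
    \<open>k\<close>.\<close>
  proof (rule dense_ge_bounded[of _ 0])
    fix w assume w: "ereal k1 < w" "w < 0"
    then obtain k where k: "w = ereal k" "k1 < k" "k < 0" by (cases w) auto
    then show "ein N g \<le> w"
      using Scal_pos_g Ein_pos_g[of k] \<open>k0 > 0\<close> by (auto simp: ein_def intro!: INF_lower)
  qed (use \<open>k1 < 0\<close> in simp)
  then have ein: "ein N g = ereal k1" using bounds[OF self] by auto
  have "Ein_conf N g = Ein N g"
    unfolding Ein_conf_def Ein using bounds self Ein
    by (intro antisym SUP_least) (auto intro: SUP_upper2)
  moreover have "ein_conf N g = ein N g"
    unfolding ein_conf_def ein using bounds self ein
    by (intro antisym INF_greatest) (auto intro: INF_lower2)
  ultimately show ?thesis using Ein ein self k0 k1 by simp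
qed

end
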